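(* If $\alpha$ is a non-computable left-c.e. real, then there exists a left-c.e. real $\beta$ such that $\alpha\neq\beta+\gamma$ for all left-c.e. reals $\gamma$ and all right-c.e. reals $\gamma$.
   Context: A real $x$ is left-c.e. if its left Dedekind cut $\{q\in\mathbb{Q}: q<x\}$ is computably enumerable (equivalently, $x$ is the limit of a computable non-decreasing sequence of rationals). A real $x$ is right-c.e. if its right Dedekind cut $\{q\in\mathbb{Q}: q>x\}$ is computably enumerable (equivalently, $x$ is the limit of a computable non-increasing sequence of rationals). *)

theory Defs
  imports Complex_Main "HOL-Library.Countable"
begin

text \<open>
  Kleene's partial recursive functions on tuples of natural numbers, as programs with a
  big-step evaluation relation; a program diverges on a tuple if no value is related to it.
  Arities are not part of the syntax: one program may be applied to tuples of different
  lengths, and an application not matching any rule diverges.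
\<close>

datatype recf =
    Zero
  | Succ
  | Proj nat
  | Comp recf "recf list"
  | PrimRec recf recf
  | Mu recf

inductive rec_eval :: "recf \<Rightarrow> nat list \<Rightarrow> nat \<Rightarrow> bool" where
  "rec_eval Zero xs 0"
| "rec_eval Succ [x] (Suc x)"
| "i < length xs \<Longrightarrow> rec_eval (Proj i) xs (xs ! i)"
| "list_all2 (\<lambda>g y. rec_eval g xs y) gs ys \<Longrightarrow> rec_eval f ys z \<Longrightarrow> rec_eval (Comp f gs) xs z"
| "rec_eval f xs z \<Longrightarrow> rec_eval (PrimRec f g) (0 # xs) z"
| "rec_eval (PrimRec f g) (n # xs) y \<Longrightarrow> rec_eval g (n # y # xs) z \<Longrightarrow>
     rec_eval (PrimRec f g) (Suc n # xs) z"
| "rec_eval f (n # xs) 0 \<Longrightarrow> (\<forall>m<n. \<exists>k. rec_eval f (m # xs) (Suc k)) \<Longrightarrow>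
     rec_eval (Mu f) xs n"

lemma rec_eval_deterministic: "rec_eval f xs y \<Longrightarrow> rec_eval f xs z \<Longrightarrow> y = z"
proof (induction arbitrary: z rule: rec_eval.induct)
  case (4 xs gs ys f z')
  from "4.prems" obtain ys' where ys': "list_all2 (\<lambda>g y. rec_eval g xs y) gs ys'" "rec_eval f ys' z"
    by (cases rule: rec_eval.cases) auto
  have "ys = ys'"
    using "4.IH"(1) ys'(1) by (auto simp: list_all2_conv_all_nth intro!: nth_equalityI)
  then show ?case using "4.IH"(2) ys'(2) by blast
next
  case (7 f n xs)
  from "7.prems" have z: "rec_eval f (z # xs) 0" "\<forall>m<z. \<exists>k. rec_eval f (m # xs) (Suc k)"
    by (cases rule: rec_eval.cases; auto)+
  show ?case
  proof (cases n z rule: linorder_cases)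
    case less
    then show ?thesis using z(2) "7.IH"(1) by (metis Zero_not_Suc)
  next
    case greater
    then show ?thesis using z(1) "7.IH"(2) by (metis Zero_not_Suc)
  qed
next
  case (6 f g n xs y z')
  from "6.prems" obtain y' where "rec_eval (PrimRec f g) (n # xs) y'" "rec_eval g (n # y' # xs) z"
    by (cases rule: rec_eval.cases) auto
  then show ?case using "6.IH" by blast
qed (erule rec_eval.cases; auto)+

definition computable_fun :: "(nat \<Rightarrow> nat) \<Rightarrow> bool" where
  "computable_fun f \<longleftrightarrow> (\<exists>p. \<forall>n. rec_eval p [n] (f n))"

definition ce_nat_set :: "nat set \<Rightarrow> bool" where
  "ce_nat_set A \<longleftrightarrow> (\<exists>p. A = {n. \<exists>y. rec_eval p [n] y})"

text \<open>
  Rationals are coded by the surjection \<^const>\<open>nat_to_rat_surj\<close>, which pairs numerator and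
  denominator.  A rational has infinitely many codes, but equality of the coded rationals is
  decidable, so asking for the set of all codes to be c.e. is the same as asking for an
  effective enumeration of the rationals themselves.
\<close>

definition ce_rat_set :: "rat set \<Rightarrow> bool" where
  "ce_rat_set A \<longleftrightarrow> ce_nat_set {n. nat_to_rat_surj n \<in> A}"

definition left_ce :: "real \<Rightarrow> bool" where
  "left_ce x \<longleftrightarrow> ce_rat_set {q. real_of_rat q < x}"

definition right_ce :: "real \<Rightarrow> bool" where
  "right_ce x \<longleftrightarrow> ce_rat_set {q. real_of_rat q > x}"

definition computable_real :: "real \<Rightarrow> bool" where
  "computable_real x \<longleftrightarrow>
     (\<exists>f. computable_fun f \<and> (\<forall>n. \<bar>x - real_of_rat (nat_to_rat_surj (f n))\<bar> \<le> 1 / 2 ^ n))"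

end

theory Submission
  imports Defs
begin

text \<open>
  Fix left-c.e. reals \<open>\<alpha>\<close>, \<open>\<eta>\<close>, \<open>\<omega>\<close> with approximations \<open>a\<close>, \<open>h\<close>, \<open>w\<close>.  A finite injury
  construction builds left-c.e. reals \<open>u\<close> and \<open>v\<close> such that neither \<open>d = \<alpha> + u - v\<close> nor
  \<open>- d\<close> is left-c.e.: whenever \<open>d\<close> seems to agree with a left-c.e. real, the responsible
  requirement adds to \<open>v\<close> the next increment of \<open>w\<close>, scaled by a fixed power of two, and for
  \<open>- d\<close> it adds to \<open>u\<close> an increment of \<open>h\<close>.  A requirement acting infinitely often would force
  \<open>\<alpha> - 2\<^sup>-\<^sup>m \<omega>\<close>, respectively \<open>- \<alpha> - 2\<^sup>-\<^sup>m \<eta>\<close>, to be left-c.e.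

  If some left-c.e. \<open>\<omega>\<close> makes all \<open>\<alpha> - 2\<^sup>-\<^sup>m \<omega>\<close> not left-c.e. (so \<open>\<alpha>\<close> is not complete for
  Solovay reducibility), then \<open>\<eta> = 0\<close> gives \<open>u = 0\<close>, and \<open>\<beta> = v\<close> works.  Otherwise run the
  construction with \<open>0\<close> in place of \<open>\<alpha>\<close> and with \<open>\<alpha>\<close> in place of \<open>\<eta>\<close> and \<open>\<omega>\<close>; now
  \<open>\<alpha> - 2\<^sup>-\<^sup>m u\<close> is left-c.e. for some \<open>m\<close>, and \<open>\<beta> = \<alpha> - 2\<^sup>-\<^sup>m u + 2\<^sup>-\<^sup>m v\<close> works because
  \<open>\<alpha> - \<beta> = 2\<^sup>-\<^sup>m (u - v)\<close>.
\<close>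

subsection \<open>Programs for pairing, primitive recursion and search\<close>

lemma rec_eval_Comp1:
  "rec_eval g xs a \<Longrightarrow> rec_eval f [a] z \<Longrightarrow> rec_eval (Comp f [g]) xs z"
  by (rule rec_eval.intros(4)[where ys = "[a]"]) auto

lemma rec_eval_Comp2:
  "rec_eval g1 xs a \<Longrightarrow> rec_eval g2 xs b \<Longrightarrow> rec_eval f [a, b] z \<Longrightarrow>
    rec_eval (Comp f [g1, g2]) xs z"
  by (rule rec_eval.intros(4)[where ys = "[a, b]"]) auto

lemma rec_eval_Proj_eq: "i < length xs \<Longrightarrow> y = xs ! i \<Longrightarrow> rec_eval (Proj i) xs y"
  by (auto intro: rec_eval.intros)

lemma rec_eval_Succ_eq: "y = Suc x \<Longrightarrow> rec_eval Succ [x] y"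
  by (auto intro: rec_eval.intros)

lemma rec_eval_PrimRec:
  assumes "rec_eval f xs (h 0)"
    and "\<And>n. rec_eval g (n # h n # xs) (h (Suc n))"
  shows "rec_eval (PrimRec f g) (n # xs) (h n)"
  by (induction n) (use assms in \<open>auto intro: rec_eval.intros\<close>)

text \<open>Totality of the inner program supplies the nonzero values that the rule for
  \<open>Mu\<close> demands below the least zero.\<close>

lemma rec_eval_Mu_Least:
  assumes f: "\<And>n. rec_eval f (n # xs) (h n)" and ex: "\<exists>n. h n = 0"
  shows "rec_eval (Mu f) xs (LEAST n. h n = 0)"
proof (rule rec_eval.intros(7))
  have "h (LEAST n. h n = 0) = 0"
    using ex by (rule LeastI_ex)
  then show "rec_eval f ((LEAST n. h n = 0) # xs) 0"
    using f by metis
  show "\<forall>m<LEAST n. h n = 0. \<exists>k. rec_eval f (m # xs) (Suc k)"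
    using f not_less_Least by (metis not0_implies_Suc)
qed

lemma ex_rec_plus: "\<exists>p. \<forall>x y. rec_eval p [x, y] (x + y)"
proof (intro exI allI)
  show "rec_eval (PrimRec (Proj 0) (Comp Succ [Proj 1])) [x, y] (x + y)" for x y
    by (rule rec_eval_PrimRec[where h = "\<lambda>x. x + y"])
      (auto intro!: rec_eval_Proj_eq rec_eval_Comp1 rec_eval_Succ_eq)
qed

lemma ex_rec_pred: "\<exists>p. \<forall>x. rec_eval p [x] (x - 1)"
proof (intro exI allI)
  show "rec_eval (PrimRec Zero (Proj 0)) [x] (x - 1)" for x
    by (rule rec_eval_PrimRec[where h = "\<lambda>x. x - 1"])
      (auto intro!: rec_eval_Proj_eq rec_eval.intros(1))
qed

text \<open>Recursion runs on the first argument, so this is the number subtracted, one predecessor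
  per step.\<close>

lemma ex_rec_diff: "\<exists>p. \<forall>x y. rec_eval p [x, y] (y - x)"
proof -
  obtain p where p: "\<And>x. rec_eval p [x] (x - 1)"
    using ex_rec_pred by blast
  have "rec_eval (PrimRec (Proj 0) (Comp p [Proj 1])) [x, y] (y - x)" for x y
    by (rule rec_eval_PrimRec[where h = "\<lambda>x. y - x"])
      (use p[of "y - n" for n] in \<open>auto intro!: rec_eval_Proj_eq rec_eval_Comp1\<close>)
  then show ?thesis by blast
qed

lemma ex_rec_triangle: "\<exists>p. \<forall>x. rec_eval p [x] (triangle x)"
proof -
  obtain p where p: "\<And>x y. rec_eval p [x, y] (x + y)"
    using ex_rec_plus by blast
  have "rec_eval (PrimRec Zero (Comp Succ [Comp p [Proj 0, Proj 1]])) [x] (triangle x)" for x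
  proof (rule rec_eval_PrimRec)
    show "rec_eval (Comp Succ [Comp p [Proj 0, Proj 1]]) [n, triangle n] (triangle (Suc n))" for n
      by (rule rec_eval_Comp1, rule rec_eval_Comp2[OF _ _ p])
        (auto intro!: rec_eval_Proj_eq rec_eval_Succ_eq)
  qed (auto intro: rec_eval.intros)
  then show ?thesis by blast
qed

lemma ex_rec_prod_encode: "\<exists>p. \<forall>x y. rec_eval p [x, y] (prod_encode (x, y))"
proof -
  obtain p where p: "\<And>x y. rec_eval p [x, y] (x + y)"
    using ex_rec_plus by blast
  obtain t where t: "\<And>x. rec_eval t [x] (triangle x)"
    using ex_rec_triangle by blast
  have "rec_eval (Comp p [Comp t [p], Proj 0]) [x, y] (triangle (x + y) + x)" for x y
    by (rule rec_eval_Comp2[OF _ _ p], rule rec_eval_Comp1[OF p t])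
      (auto intro!: rec_eval_Proj_eq)
  then show ?thesis
    by (auto simp: prod_encode_def)
qed

text \<open>The pair \<open>(m, n)\<close> with code \<open>z\<close> lies on the diagonal
  \<open>m + n\<close>, and \<open>z = triangle (m + n) + m\<close>. Truncated subtraction expresses
  \<open>z < triangle (Suc k)\<close>, so \<open>r z\<close> is that diagonal and both components
  follow from it.\<close>

lemma prod_decode_conv_Least:
  defines "r \<equiv> \<lambda>z. LEAST k. Suc z - triangle (Suc k) = 0"
  shows "fst (prod_decode z) = z - triangle (r z)"
    and "snd (prod_decode z) = triangle (r z) + r z - z"
    and "\<exists>k. Suc z - triangle (Suc k) = 0"
proof -
  obtain m n where mn: "prod_decode z = (m, n)"
    by (cases "prod_decode z")
  have z: "z = triangle (m + n) + m"
    using mn prod_decode_inverse[of z] by (simp add: prod_encode_def)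
  have mono: "triangle i \<le> triangle j" if "i \<le> j" for i j
    unfolding triangle_def using that by (intro div_le_mono mult_le_mono) auto
  have wit: "Suc z - triangle (Suc (m + n)) = 0"
    by (simp add: z)
  have "r z = m + n"
    unfolding r_def
  proof (rule Least_equality[where P = "\<lambda>k. Suc z - triangle (Suc k) = 0"])
    show "Suc z - triangle (Suc (m + n)) = 0" by (rule wit)
    show "m + n \<le> k" if "Suc z - triangle (Suc k) = 0" for k
    proof (rule ccontr)
      assume "\<not> m + n \<le> k"
      then have "triangle (Suc k) \<le> triangle (m + n)"
        by (intro mono) auto
      then show False
        using that z by auto
    qed
  qed
  then show "fst (prod_decode z) = z - triangle (r z)"
    "snd (prod_decode z) = triangle (r z) + r z - z"
    by (simp_all add: mn) (simp_all add: z)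
  show "\<exists>k. Suc z - triangle (Suc k) = 0"
    using wit by blast
qed

lemma ex_rec_prod_decode:
  "\<exists>p. \<forall>z. rec_eval p [z] (fst (prod_decode z))"
  "\<exists>p. \<forall>z. rec_eval p [z] (snd (prod_decode z))"
proof -
  obtain p where p: "\<And>x y. rec_eval p [x, y] (x + y)"
    using ex_rec_plus by blast
  obtain d where d: "\<And>x y. rec_eval d [x, y] (y - x)"
    using ex_rec_diff by blast
  obtain t where t: "\<And>x. rec_eval t [x] (triangle x)"
    using ex_rec_triangle by blast
  define r where "r = Mu (Comp d [Comp t [Comp Succ [Proj 0]], Comp Succ [Proj 1]])"
  have r: "rec_eval r [z] (LEAST k. Suc z - triangle (Suc k) = 0)" for z
    unfolding r_def
  proof (rule rec_eval_Mu_Least)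
    show "rec_eval (Comp d [Comp t [Comp Succ [Proj 0]], Comp Succ [Proj 1]]) [k, z]
        (Suc z - triangle (Suc k))" for k
      by (rule rec_eval_Comp2[OF _ _ d], rule rec_eval_Comp1[OF _ t])
        (auto intro!: rec_eval_Comp1 rec_eval_Proj_eq rec_eval_Succ_eq)
  qed (rule prod_decode_conv_Least)
  have "rec_eval (Comp d [Comp t [r], Proj 0]) [z] (fst (prod_decode z))" for z
    unfolding prod_decode_conv_Least(1)
    by (rule rec_eval_Comp2[OF _ _ d], rule rec_eval_Comp1[OF r t]) (auto intro!: rec_eval_Proj_eq)
  then show "\<exists>p. \<forall>z. rec_eval p [z] (fst (prod_decode z))" by blast
  have "rec_eval (Comp d [Proj 0, Comp p [Comp t [r], r]]) [z] (snd (prod_decode z))" for z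
    unfolding prod_decode_conv_Least(2)
    by (rule rec_eval_Comp2[OF _ _ d], rule rec_eval_Proj_eq, simp, simp,
        rule rec_eval_Comp2[OF _ r p], rule rec_eval_Comp1[OF r t])
  then show "\<exists>p. \<forall>z. rec_eval p [z] (snd (prod_decode z))" by blast
qed

section \<open>Closure properties of computable functions on numbers\<close>

lemma computable_fun_compose:
  assumes "computable_fun f" "computable_fun g"
  shows "computable_fun (\<lambda>n. f (g n))"
  using assms unfolding computable_fun_def by (meson rec_eval_Comp1)

lemma computable_fun_id: "computable_fun (\<lambda>n. n)"
  unfolding computable_fun_def
  by (intro exI[of _ "Proj 0"] allI rec_eval_Proj_eq) auto

lemma computable_fun_Suc: "computable_fun Suc"
  unfolding computable_fun_def by (auto intro: rec_eval.intros)

lemma computable_fun_const: "computable_fun (\<lambda>_. k)"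
proof (induction k)
  case 0
  then show ?case
    unfolding computable_fun_def by (auto intro: rec_eval.intros)
next
  case (Suc k)
  then show ?case
    using computable_fun_compose[OF computable_fun_Suc] by blast
qed

lemma computable_fun_prod_encode:
  assumes "computable_fun f" "computable_fun g"
  shows "computable_fun (\<lambda>n. prod_encode (f n, g n))"
proof -
  obtain p where "\<And>x y. rec_eval p [x, y] (prod_encode (x, y))"
    using ex_rec_prod_encode by blast
  then show ?thesis
    using assms unfolding computable_fun_def by (meson rec_eval_Comp2)
qed

lemma computable_fun_fst: "computable_fun (\<lambda>n. fst (prod_decode n))"
  and computable_fun_snd: "computable_fun (\<lambda>n. snd (prod_decode n))"
  using ex_rec_prod_decode unfolding computable_fun_def by blast+

lemma computable_fun_rec_nat:
  assumes "computable_fun a" "computable_fun b" "computable_fun h"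
  shows "computable_fun (\<lambda>c. rec_nat (a c) (\<lambda>n y. h (prod_encode (c, prod_encode (n, y)))) (b c))"
proof -
  obtain pa pb ph where p: "\<And>n. rec_eval pa [n] (a n)" "\<And>n. rec_eval pb [n] (b n)"
    "\<And>n. rec_eval ph [n] (h n)"
    using assms unfolding computable_fun_def by blast
  obtain e where e: "\<And>x y. rec_eval e [x, y] (prod_encode (x, y))"
    using ex_rec_prod_encode by blast
  \<comment> \<open>\<open>PrimRec\<close> passes the counter and the previous value before the
    parameter, whereas \<open>h\<close> expects the parameter first.\<close>
  define g where "g = Comp ph [Comp e [Proj 2, Comp e [Proj 0, Proj 1]]]"
  have g: "rec_eval g [n, y, c] (h (prod_encode (c, prod_encode (n, y))))" for n y c
    unfolding g_def
    by (rule rec_eval_Comp1[OF rec_eval_Comp2[OF _ rec_eval_Comp2[OF _ _ e] e] p(3)])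
      (auto intro: rec_eval_Proj_eq)
  have "rec_eval (PrimRec pa g) [n, c]
      (rec_nat (a c) (\<lambda>n y. h (prod_encode (c, prod_encode (n, y)))) n)" for n c
    by (rule rec_eval_PrimRec) (use p g in simp_all)
  then have "rec_eval (Comp (PrimRec pa g) [pb, Proj 0]) [c]
      (rec_nat (a c) (\<lambda>n y. h (prod_encode (c, prod_encode (n, y)))) (b c))" for c
    by (intro rec_eval_Comp2[OF p(2)]) (auto intro: rec_eval_Proj_eq)
  then show ?thesis
    unfolding computable_fun_def by blast
qed

lemma computable_fun_Least:
  assumes h: "computable_fun h" and ex: "\<And>c. \<exists>n. h (prod_encode (c, n)) = 0"
  shows "computable_fun (\<lambda>c. LEAST n. h (prod_encode (c, n)) = 0)"
proof -
  obtain p where p: "\<And>n. rec_eval p [n] (h n)"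
    using h unfolding computable_fun_def by blast
  obtain e where e: "\<And>x y. rec_eval e [x, y] (prod_encode (x, y))"
    using ex_rec_prod_encode by blast
  have "rec_eval (Mu (Comp p [Comp e [Proj 1, Proj 0]])) [c]
      (LEAST n. h (prod_encode (c, n)) = 0)" for c
    by (rule rec_eval_Mu_Least[OF rec_eval_Comp1[OF rec_eval_Comp2[OF _ _ e] p] ex])
      (auto intro: rec_eval_Proj_eq)
  then show ?thesis
    unfolding computable_fun_def by blast
qed

subsection \<open>Computable functions between numbered types\<close>

text \<open>
  A numbering need not be injective, so that the one of \<^typ>\<open>rat\<close> can be
  \<^const>\<open>nat_to_rat_surj\<close>.  A function is computable if it is realized on codes, and this
  includes that the realizing function respects equality of the coded objects.
\<close>

class numbered =
  fixes dec :: "nat \<Rightarrow> 'a"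
  assumes surj_dec: "surj dec"

instantiation nat :: numbered
begin
definition dec_nat :: "nat \<Rightarrow> nat" where "dec_nat n = n"
instance by standard (simp add: dec_nat_def surj_def)
end

instantiation bool :: numbered
begin
text \<open>Zero codes truth, so a realizer of a predicate is directly the function whose zero
  \<open>Mu\<close> searches for.\<close>

definition dec_bool :: "nat \<Rightarrow> bool" where "dec_bool n \<longleftrightarrow> n = 0"
instance
proof
  show "surj (dec :: nat \<Rightarrow> bool)"
    by (rule surjI[where f = "\<lambda>b. if b then 0 else 1"]) (simp add: dec_bool_def)
qed
end

instantiation prod :: (numbered, numbered) numbered
begin
definition dec_prod :: "nat \<Rightarrow> 'a \<times> 'b" where
  "dec_prod n = map_prod dec dec (prod_decode n)"
instance
proof
  show "surj (dec :: nat \<Rightarrow> 'a \<times> 'b)"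
  proof (rule surjI)
    fix x :: "'a \<times> 'b"
    show "dec (prod_encode (inv dec (fst x), inv dec (snd x))) = x"
      by (simp add: dec_prod_def surj_f_inv_f[OF surj_dec])
  qed
qed
end

instantiation list :: (numbered) numbered
begin
definition dec_list :: "nat \<Rightarrow> 'a list" where
  "dec_list n = map dec (list_decode n)"
instance
proof
  show "surj (dec :: nat \<Rightarrow> 'a list)"
  proof (rule surjI)
    fix xs :: "'a list"
    have "(dec :: nat \<Rightarrow> 'a) \<circ> inv dec = id"
      using surj_dec by (simp add: surj_iff)
    then show "dec (list_encode (map (inv dec) xs)) = xs"
      by (simp add: dec_list_def)
  qed
qed
end

instantiation int :: numbered
begin
definition dec_int :: "nat \<Rightarrow> int" where "dec_int = int_decode"
instance by standard (simp add: dec_int_def surj_int_decode)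
end

instantiation rat :: numbered
begin
definition dec_rat :: "nat \<Rightarrow> rat" where "dec_rat = nat_to_rat_surj"
instance by standard (simp add: dec_rat_def surj_nat_to_rat_surj)
end

definition computable :: "('a::numbered \<Rightarrow> 'b::numbered) \<Rightarrow> bool" where
  "computable f \<longleftrightarrow> (\<exists>g. computable_fun g \<and> (\<forall>n. f (dec n) = dec (g n)))"

lemma computableI:
  assumes "computable_fun g" "\<And>n. f (dec n) = dec (g n)"
  shows "computable f"
  unfolding computable_def using assms by (intro exI[of _ g] conjI allI)

definition realizer :: "('a::numbered \<Rightarrow> 'b::numbered) \<Rightarrow> nat \<Rightarrow> nat" where
  "realizer f = (SOME g. computable_fun g \<and> (\<forall>n. f (dec n) = dec (g n)))"

lemma computableD:
  assumes "computable f"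
  shows computable_fun_realizer: "computable_fun (realizer f)"
    and "f (dec n) = dec (realizer f n)"
proof -
  have "computable_fun (realizer f) \<and> (\<forall>n. f (dec n) = dec (realizer f n))"
    unfolding realizer_def using someI_ex[OF assms[unfolded computable_def]] .
  then show "computable_fun (realizer f)" "f (dec n) = dec (realizer f n)"
    by simp_all
qed

section \<open>Injective numberings\<close>

lemma inj_dec_nat: "inj (dec :: nat \<Rightarrow> nat)"
  by (simp add: dec_nat_def inj_def)

lemma inj_dec_prod:
  assumes "inj (dec :: nat \<Rightarrow> 'a::numbered)" "inj (dec :: nat \<Rightarrow> 'b::numbered)"
  shows "inj (dec :: nat \<Rightarrow> 'a \<times> 'b)"
proof (rule injI)
  fix m n :: nat
  assume "(dec m :: 'a \<times> 'b) = dec n"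
  then have "prod_decode m = prod_decode n"
    by (auto simp: dec_prod_def assms inj_eq prod_eq_iff)
  then show "m = n" by simp
qed

lemma inj_dec_list:
  assumes "inj (dec :: nat \<Rightarrow> 'a::numbered)"
  shows "inj (dec :: nat \<Rightarrow> 'a list)"
proof (rule injI)
  fix m n :: nat
  assume "(dec m :: 'a list) = dec n"
  then have "list_decode m = list_decode n"
    using assms by (simp add: dec_list_def inj_map_eq_map)
  then show "m = n" by (simp add: list_decode_eq)
qed

section \<open>Basic closure properties of computable maps\<close>

named_theorems computable_intros

lemma computable_id [computable_intros]: "computable (\<lambda>x. x)"
  by (rule computableI[OF computable_fun_id]) simp

lemma computable_const [computable_intros]: "computable (\<lambda>_. k)"
proof -
  obtain n where "k = dec n"
    using surjD[OF surj_dec] by blast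
  then show ?thesis
    by (intro computableI[OF computable_fun_const]) simp
qed

lemma computable_compose:
  assumes "computable f" "computable g"
  shows "computable (\<lambda>x. f (g x))"
  by (rule computableI[OF computable_fun_compose[OF assms[THEN computableD(1)]]])
    (simp add: assms[THEN computableD(2)])

lemma computable_Suc [computable_intros]: "computable f \<Longrightarrow> computable (\<lambda>x. Suc (f x))"
  by (rule computable_compose[of Suc], rule computableI[OF computable_fun_Suc]) (simp add: dec_nat_def)

lemma computable_Pair [computable_intros]:
  assumes "computable f" "computable g"
  shows "computable (\<lambda>x. (f x, g x))"
  by (rule computableI[OF computable_fun_prod_encode[OF assms[THEN computableD(1)]]])
    (simp add: assms[THEN computableD(2)] dec_prod_def)

lemma computable_fst [computable_intros]: "computable f \<Longrightarrow> computable (\<lambda>x. fst (f x))"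
  by (rule computable_compose[of fst], rule computableI[OF computable_fun_fst]) (simp add: dec_prod_def)

lemma computable_snd [computable_intros]: "computable f \<Longrightarrow> computable (\<lambda>x. snd (f x))"
  by (rule computable_compose[of snd], rule computableI[OF computable_fun_snd]) (simp add: dec_prod_def)

lemma computable_rec_nat [computable_intros]:
  assumes "computable a" "computable b" "computable (\<lambda>z. h (fst z) (fst (snd z)) (snd (snd z)))"
  shows "computable (\<lambda>c. rec_nat (a c) (h c) (b c))"
proof -
  note a' = computableD[OF assms(1)] and b' = computableD[OF assms(2)]
  let ?h = "realizer (\<lambda>z. h (fst z) (fst (snd z)) (snd (snd z)))"
  note h' = computableD[OF assms(3)]
  have h: "h (dec c) n (dec y) = dec (?h (prod_encode (c, prod_encode (n, y))))" for c n y
    using h'(2)[of "prod_encode (c, prod_encode (n, y))"] by (simp add: dec_prod_def dec_nat_def)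
  have "rec_nat (dec x) (h (dec c)) n =
      dec (rec_nat x (\<lambda>n y. ?h (prod_encode (c, prod_encode (n, y)))) n)" for x n c
    by (induction n) (auto simp: h)
  then show ?thesis
    by (intro computableI[OF computable_fun_rec_nat[OF a'(1) b'(1) h'(1)]])
      (simp add: a' b' dec_nat_def)
qed

lemma computable_If [computable_intros]:
  assumes "computable P" "computable f" "computable g"
  shows "computable (\<lambda>x. if P x then f x else g x)"
proof -
  define P' where "P' = realizer P"
  have P': "computable_fun P'" "P (dec n) = dec (P' n)" for n
    unfolding P'_def using assms(1) by (rule computableD)+
  \<comment> \<open>The number \<open>P' k\<close> may depend on the code and not only on the coded
    object. Replacing it by 0 or 1 gives a function of \<open>x\<close>, and recursion with a
    constant step then selects the branch.\<close>
  define n where "n = (\<lambda>x. if P x then 0 else Suc 0)"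
  have "computable_fun (\<lambda>k. rec_nat 0 (\<lambda>_ _. Suc 0) (P' k))"
    using computable_fun_rec_nat[OF computable_fun_const P'(1) computable_fun_const[of "Suc 0"]]
    by simp
  moreover have "n (dec k) = rec_nat 0 (\<lambda>_ _. Suc 0) (P' k)" for k
    by (cases "P' k") (auto simp: n_def P' dec_bool_def)
  ultimately have n: "computable n"
    by (intro computableI) (auto simp: dec_nat_def)
  have "computable (\<lambda>x. rec_nat (f x) (\<lambda>_ _. g x) (n x))"
    by (intro computable_intros n computable_compose[OF assms(3)] assms(2))
  moreover have "rec_nat (f x) (\<lambda>_ _. g x) (n x) = (if P x then f x else g x)" for x
    by (simp add: n_def)
  ultimately show ?thesis by simp
qed

lemma computable_Least:
  fixes P :: "'a::numbered \<Rightarrow> nat \<Rightarrow> bool"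
  assumes P: "computable (\<lambda>z. P (fst z) (snd z))" and ex: "\<And>c. \<exists>n. P c n"
  shows "computable (\<lambda>c. LEAST n. P c n)"
proof -
  let ?h = "realizer (\<lambda>z. P (fst z) (snd z))"
  note h = computableD[OF P]
  have "P (dec c) n \<longleftrightarrow> ?h (prod_encode (c, n)) = 0" for c n
    using h(2)[of "prod_encode (c, n)"] by (simp add: dec_prod_def dec_nat_def dec_bool_def)
  with ex show ?thesis
    by (intro computableI[OF computable_fun_Least[OF h(1)]]) (simp_all add: dec_nat_def, metis)
qed

section \<open>Decidable predicates and arithmetic of natural numbers\<close>

lemma computable_conj [computable_intros]: "computable P \<Longrightarrow> computable Q \<Longrightarrow> computable (\<lambda>x. P x \<and> Q x)"
proof -
  assume "computable P" "computable Q"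
  then have "computable (\<lambda>x. if P x then Q x else False)"
    by (intro computable_intros)
  then show ?thesis
    by (rule back_subst[of computable]) auto
qed

lemma computable_not [computable_intros]: "computable P \<Longrightarrow> computable (\<lambda>x. \<not> P x)"
proof -
  assume "computable P"
  then have "computable (\<lambda>x. if P x then False else True)"
    by (intro computable_intros)
  then show ?thesis
    by (rule back_subst[of computable]) auto
qed

lemma computable_disj [computable_intros]: "computable P \<Longrightarrow> computable Q \<Longrightarrow> computable (\<lambda>x. P x \<or> Q x)"
proof -
  assume "computable P" "computable Q"
  then have "computable (\<lambda>x. if P x then True else Q x)"
    by (intro computable_intros)
  then show ?thesis
    by (rule back_subst[of computable]) auto
qed

lemma computable_add_nat [computable_intros]:
  fixes f g :: "'a::numbered \<Rightarrow> nat"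
  assumes "computable f" "computable g"
  shows "computable (\<lambda>x. f x + g x)"
proof -
  have "rec_nat a (\<lambda>_ y. Suc y) b = a + b" for a b :: nat
    by (induction b) auto
  moreover have "computable (\<lambda>x. rec_nat (f x) (\<lambda>_ y. Suc y) (g x))"
    by (intro computable_intros assms)
  ultimately show ?thesis by simp
qed

lemma computable_mult_nat [computable_intros]:
  fixes f g :: "'a::numbered \<Rightarrow> nat"
  assumes "computable f" "computable g"
  shows "computable (\<lambda>x. f x * g x)"
proof -
  have "rec_nat 0 (\<lambda>_ y. y + a) b = a * b" for a b :: nat
    by (induction b) auto
  moreover have "computable (\<lambda>x. rec_nat 0 (\<lambda>_ y. y + f x) (g x))"
    by (intro computable_intros assms computable_compose[OF assms(1)])
  ultimately show ?thesis by simp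
qed

lemma computable_diff_nat [computable_intros]:
  fixes f g :: "'a::numbered \<Rightarrow> nat"
  assumes "computable f" "computable g"
  shows "computable (\<lambda>x. f x - g x)"
proof -
  have pred: "rec_nat 0 (\<lambda>n _. n) b = b - 1" for b :: nat
    by (cases b) auto
  have "rec_nat a (\<lambda>_ y. rec_nat 0 (\<lambda>n _. n) y) b = a - b" for a b :: nat
    by (induction b) (auto simp: pred)
  moreover have "computable (\<lambda>x. rec_nat (f x) (\<lambda>_ y. rec_nat 0 (\<lambda>n _. n) y) (g x))"
    by (intro computable_intros assms)
  ultimately show ?thesis by simp
qed

lemma computable_eq_0:
  fixes f :: "'a::numbered \<Rightarrow> nat"
  assumes "computable f"
  shows "computable (\<lambda>x. f x = 0)"
proof -
  show ?thesis
    by (rule computableI[OF computableD(1)[OF assms]])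
      (use computableD(2)[OF assms] in \<open>simp add: dec_bool_def dec_nat_def\<close>)
qed

lemma computable_le_nat [computable_intros]:
  fixes f g :: "'a::numbered \<Rightarrow> nat"
  assumes "computable f" "computable g"
  shows "computable (\<lambda>x. f x \<le> g x)"
  using computable_eq_0[OF computable_diff_nat[OF assms]] by simp

lemma computable_less_nat [computable_intros]:
  fixes f g :: "'a::numbered \<Rightarrow> nat"
  assumes "computable f" "computable g"
  shows "computable (\<lambda>x. f x < g x)"
  using computable_not[OF computable_le_nat[OF assms(2,1)]] by (simp add: not_le)

text \<open>Comparing codes decides equality when distinct codes denote distinct objects.\<close>

lemma computable_eq:
  fixes f g :: "'a::numbered \<Rightarrow> 'b::numbered"
  assumes "inj (dec :: nat \<Rightarrow> 'b)" "computable f" "computable g"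
  shows "computable (\<lambda>x. f x = g x)"
proof -
  have nat: "computable (\<lambda>x. a x = b x)" if "computable a" "computable b" for a b :: "nat \<Rightarrow> nat"
    unfolding eq_iff by (intro computable_intros that)
  have "computable (realizer f)" "computable (realizer g)"
    by (rule computableI[OF computableD(1)], rule assms, simp add: dec_nat_def)+
  then have eq: "computable (\<lambda>n. realizer f n = realizer g n)"
    by (rule nat)
  show ?thesis
  proof (rule computableI[OF computableD(1)[OF eq]])
    fix n
    show "(f (dec n) = g (dec n)) = dec (realizer (\<lambda>n. realizer f n = realizer g n) n)"
      using computableD(2)[OF eq, of n] assms(1)
      by (simp add: computableD(2)[OF assms(2)] computableD(2)[OF assms(3)] inj_eq dec_nat_def)
  qed
qed

lemmas computable_eq_inj [computable_intros] =
  computable_eq[OF inj_dec_nat]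
  computable_eq[OF inj_dec_prod[OF inj_dec_nat inj_dec_nat]]
  computable_eq[OF inj_dec_list[OF inj_dec_nat]]
  computable_eq[OF inj_dec_prod[OF inj_dec_nat inj_dec_prod[OF inj_dec_list[OF inj_dec_nat] inj_dec_nat]]]

text \<open>The alternative \<open>k = b x\<close> makes the search total; it stops before
  \<open>b x\<close> exactly if a witness exists there.\<close>

lemma computable_bex_less [computable_intros]:
  fixes b :: "'a::numbered \<Rightarrow> nat"
  assumes "computable b" "computable (\<lambda>z. P (fst z) (snd z))"
  shows "computable (\<lambda>x. \<exists>k<b x. P x k)"
proof -
  have "computable (\<lambda>x. (LEAST k. k = b x \<or> P x k) < b x)"
    by (intro computable_intros computable_Least assms computable_compose[OF assms(1)]) auto
  moreover have "(LEAST k. k = b x \<or> P x k) < b x \<longleftrightarrow> (\<exists>k<b x. P x k)" for x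
  proof
    assume "(LEAST k. k = b x \<or> P x k) < b x"
    moreover have "(LEAST k. k = b x \<or> P x k) = b x \<or> P x (LEAST k. k = b x \<or> P x k)"
      by (rule LeastI[of "\<lambda>k. k = b x \<or> P x k" "b x"]) simp
    ultimately show "\<exists>k<b x. P x k" by auto
  next
    assume "\<exists>k<b x. P x k"
    then obtain k where "k < b x" "P x k" by blast
    then show "(LEAST k. k = b x \<or> P x k) < b x"
      using Least_le[of "\<lambda>k. k = b x \<or> P x k" k] by auto
  qed
  ultimately show ?thesis by simp
qed

lemma computable_ball_less [computable_intros]:
  fixes b :: "'a::numbered \<Rightarrow> nat"
  assumes "computable b" "computable (\<lambda>z. P (fst z) (snd z))"
  shows "computable (\<lambda>x. \<forall>k<b x. P x k)"
proof -
  have "computable (\<lambda>x. \<not> (\<exists>k<b x. \<not> P x k))"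
    by (intro computable_intros assms)
  then show ?thesis by simp
qed

section \<open>Decoding and list operations\<close>

lemma computable_prod_decode [computable_intros]: "computable f \<Longrightarrow> computable (\<lambda>x. prod_decode (f x))"
  by (rule computable_compose[of prod_decode], rule computableI[OF computable_fun_id])
    (simp add: dec_prod_def dec_nat_def[abs_def] prod.map_ident)

lemma computable_list_decode [computable_intros]: "computable f \<Longrightarrow> computable (\<lambda>x. list_decode (f x))"
  by (rule computable_compose[of list_decode], rule computableI[OF computable_fun_id])
    (simp add: dec_list_def dec_nat_def[abs_def])

lemma computable_nat_iff:
  fixes f :: "nat \<Rightarrow> nat"
  shows "computable f \<longleftrightarrow> computable_fun f"
proof
  assume f: "computable f"
  have "f = realizer f"
    using computableD(2)[OF f] by (simp add: dec_nat_def fun_eq_iff)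
  then show "computable_fun f"
    using computableD(1)[OF f] by simp
qed (auto intro: computableI simp: dec_nat_def)

lemma computable_dec: "computable dec"
  by (rule computableI[OF computable_fun_id]) (simp add: dec_nat_def)

lemmas computable_dec_compose [computable_intros] = computable_compose[OF computable_dec]

lemma computable_fun_pred: "computable_fun (\<lambda>n. n - 1)"
  unfolding computable_nat_iff[symmetric] by (intro computable_intros)

lemma dec_list_0: "dec 0 = []"
  by (simp add: dec_list_def)

lemma dec_list_Suc: "dec (Suc n) = dec (fst (prod_decode n)) # dec (snd (prod_decode n))"
  by (simp add: dec_list_def split: prod.splits)

lemma computable_Cons [computable_intros]:
  assumes "computable f" "computable g"
  shows "computable (\<lambda>x. f x # g x)"
proof -
  have "computable_fun (\<lambda>n. Suc (prod_encode (realizer f n, realizer g n)))"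
    by (intro computable_fun_compose[OF computable_fun_Suc] computable_fun_prod_encode
        computableD(1) assms)
  then show ?thesis
    by (rule computableI) (simp add: dec_list_Suc computableD(2)[OF assms(1)] computableD(2)[OF assms(2)])
qed

lemma computable_tl [computable_intros]:
  fixes f :: "'a::numbered \<Rightarrow> 'b::numbered list"
  assumes "computable f"
  shows "computable (\<lambda>x. tl (f x))"
proof (rule computable_compose[OF _ assms, of tl])
  show "computable (tl :: 'b list \<Rightarrow> 'b list)"
  proof (rule computableI)
    \<comment> \<open>The code 0 of \<open>[]\<close> has truncated predecessor 0, which decodes to
      the pair of zeros; this gives \<open>tl [] = []\<close>.\<close>
    show "computable_fun (\<lambda>n. snd (prod_decode (n - 1)))"
      by (intro computable_fun_compose[OF computable_fun_snd] computable_fun_pred)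
    show "tl (dec n) = (dec (snd (prod_decode (n - 1))) :: 'b list)" for n
      by (cases n) (simp_all add: dec_list_0 dec_list_Suc prod_decode_def prod_decode_aux.simps)
  qed
qed

text \<open>
  The library leaves \<^term>\<open>hd []\<close> and out-of-range \<^term>\<open>xs ! i\<close> unspecified, so
  \<^const>\<open>hd\<close> and \<^const>\<open>nth\<close> are not provably computable.
\<close>

definition hd0 :: "'a::numbered list \<Rightarrow> 'a" where
  "hd0 xs = (case xs of [] \<Rightarrow> dec 0 | x # _ \<Rightarrow> x)"

lemma computable_hd0 [computable_intros]:
  fixes f :: "'a::numbered \<Rightarrow> 'b::numbered list"
  assumes "computable f"
  shows "computable (\<lambda>x. hd0 (f x))"
proof (rule computable_compose[OF _ assms, of hd0])
  show "computable (hd0 :: 'b list \<Rightarrow> 'b)"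
  proof (rule computableI)
    \<comment> \<open>On the code of \<open>[]\<close> this yields 0, hence the default value
      \<open>dec 0\<close> of \<open>hd0\<close>.\<close>
    show "computable_fun (\<lambda>n. fst (prod_decode (n - 1)))"
      by (intro computable_fun_compose[OF computable_fun_fst] computable_fun_pred)
    show "hd0 (dec n) = (dec (fst (prod_decode (n - 1))) :: 'b)" for n
      by (cases n)
        (simp_all add: hd0_def dec_list_0 dec_list_Suc prod_decode_def prod_decode_aux.simps)
  qed
qed

lemma computable_null [computable_intros]:
  fixes f :: "'a::numbered \<Rightarrow> 'b::numbered list"
  assumes "computable f"
  shows "computable (\<lambda>x. f x = [])"
proof (rule computable_compose[OF _ assms, of "\<lambda>xs. xs = []"])
  show "computable (\<lambda>xs :: 'b list. xs = [])"
  proof (rule computableI[OF computable_fun_id])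
    show "(dec n = ([] :: 'b list)) = dec n" for n
      by (cases n) (simp_all add: dec_bool_def dec_list_0 dec_list_Suc)
  qed
qed

definition nth0 :: "'a::numbered list \<Rightarrow> nat \<Rightarrow> 'a" where
  "nth0 xs i = hd0 (rec_nat xs (\<lambda>_. tl) i)"

lemma rec_nat_tl: "rec_nat xs (\<lambda>_. tl) i = drop i xs"
  by (induction i) (auto simp: drop_Suc tl_drop)

lemma nth0_eq: "i < length xs \<Longrightarrow> nth0 xs i = xs ! i"
  by (simp add: nth0_def rec_nat_tl hd0_def Cons_nth_drop_Suc[symmetric])

lemma computable_nth0 [computable_intros]:
  assumes "computable f" "computable g"
  shows "computable (\<lambda>x. nth0 (f x) (g x))"
  unfolding nth0_def by (intro computable_intros assms)

lemma computable_length [computable_intros]: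
  fixes f :: "'a::numbered \<Rightarrow> 'b::numbered list"
  assumes "computable f"
  shows "computable (\<lambda>x. length (f x))"
proof -
  have "computable (\<lambda>x. LEAST i. rec_nat (f x) (\<lambda>_. tl) i = [])"
    by (intro computable_Least computable_intros computable_compose[OF assms])
      (auto simp: rec_nat_tl)
  moreover have "(LEAST i. rec_nat (f x) (\<lambda>_. tl) i = []) = length (f x)" for x
    unfolding rec_nat_tl by (rule Least_equality) auto
  ultimately show ?thesis by simp
qed

lemma computable_length_filter [computable_intros]:
  fixes xs :: "'a::numbered \<Rightarrow> 'b::numbered list"
  assumes xs: "computable xs" and P: "computable (\<lambda>z. P (fst z) (snd z))"
  shows "computable (\<lambda>x. length (filter (P x) (xs x)))"
proof -
  have aux: "rec_nat 0 (\<lambda>i y. if Q (nth0 ys i) then Suc y else y) n = length (filter Q (take n ys))"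
    if "n \<le> length ys" for Q and ys :: "'b list" and n
    using that by (induction n) (auto simp: nth0_eq take_Suc_conv_app_nth)
  have "computable (\<lambda>x. rec_nat 0 (\<lambda>i y. if P x (nth0 (xs x) i) then Suc y else y) (length (xs x)))"
    by (intro computable_intros xs computable_compose[OF xs]
        computable_compose[OF P, of "\<lambda>z. (fst z, nth0 (xs (fst z)) (fst (snd z)))", simplified])
  then show ?thesis
    by (simp add: aux)
qed

section \<open>Halving, parity and integer arithmetic\<close>

lemma computable_div2 [computable_intros]:
  assumes "computable f"
  shows "computable (\<lambda>x. f x div 2 :: nat)"
proof -
  have "\<exists>k. n < 2 * Suc k" for n
    by (rule exI[of _ n]) simp
  then have "computable (\<lambda>x. LEAST k. f x < 2 * Suc k)"
    by (intro computable_Least computable_intros computable_compose[OF assms])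
  moreover have "(LEAST k. f x < 2 * Suc k) = f x div 2" for x
    by (rule Least_equality) auto
  ultimately show ?thesis by simp
qed

lemma computable_even [computable_intros]:
  fixes f :: "'a::numbered \<Rightarrow> nat"
  assumes "computable f"
  shows "computable (\<lambda>x. even (f x))"
proof -
  have "computable (\<lambda>x. 2 * (f x div 2) = f x)"
    by (intro computable_intros assms)
  moreover have "2 * (n div 2) = n \<longleftrightarrow> even n" for n :: nat
    by (metis dvd_triv_left even_two_times_div_two)
  ultimately show ?thesis by simp
qed

text \<open>Under \<open>int_decode\<close> the code \<open>2 * n\<close> stands for
  \<open>n\<close> and the code \<open>2 * n + 1\<close> for \<open>- n - 1\<close>. Sums, products
  and negatives of integers reduce to such differences through the positive and negative parts
  \<open>nat i\<close> and \<open>nat (- i)\<close>.\<close>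

lemma computable_int_diff:
  assumes "computable f" "computable g"
  shows "computable (\<lambda>x. int (f x) - int (g x))"
proof -
  have "computable (\<lambda>x. if g x \<le> f x then 2 * (f x - g x) else Suc (2 * (g x - Suc (f x))))"
    (is "computable ?h")
    by (intro computable_intros assms)
  moreover have "computable (\<lambda>n. int_decode n)"
    by (rule computableI[OF computable_fun_id]) (simp add: dec_nat_def dec_int_def)
  ultimately have "computable (\<lambda>x. int_decode (?h x))"
    by (rule computable_compose[rotated])
  moreover have "int_decode (?h x) = int (f x) - int (g x)" for x
    by (auto simp: int_decode_def sum_decode_def)
  ultimately show ?thesis by simp
qed

lemma computable_nat [computable_intros]: "computable f \<Longrightarrow> computable (\<lambda>x. nat (f x))"
proof (rule computable_compose[of nat])
  have c: "computable (\<lambda>n::nat. if even n then n div 2 else 0)"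
    by (intro computable_intros)
  show "computable nat"
    by (rule computableI[OF c[unfolded computable_nat_iff]])
      (auto simp: dec_nat_def dec_int_def int_decode_def sum_decode_def)
qed

lemma computable_nat_minus: "computable f \<Longrightarrow> computable (\<lambda>x. nat (- f x))"
proof (rule computable_compose[of "\<lambda>i. nat (- i)"])
  have c: "computable (\<lambda>n::nat. if even n then 0 else Suc (n div 2))"
    by (intro computable_intros)
  show "computable (\<lambda>i. nat (- i))"
    by (rule computableI[OF c[unfolded computable_nat_iff]])
      (auto simp: dec_nat_def dec_int_def int_decode_def sum_decode_def)
qed

lemma computable_add_int [computable_intros]:
  fixes f g :: "'a::numbered \<Rightarrow> int"
  assumes "computable f" "computable g"
  shows "computable (\<lambda>x. f x + g x)"
proof -
  have "i + j = int (nat i + nat j) - int (nat (- i) + nat (- j))" for i j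
    by simp
  then show ?thesis
    by (simp only:) (intro computable_int_diff computable_intros computable_nat_minus assms)
qed

lemma computable_mult_int [computable_intros]:
  fixes f g :: "'a::numbered \<Rightarrow> int"
  assumes "computable f" "computable g"
  shows "computable (\<lambda>x. f x * g x)"
proof -
  have "i * j = int (nat i * nat j + nat (- i) * nat (- j))
      - int (nat i * nat (- j) + nat (- i) * nat j)" for i j
    by (cases "0 \<le> i"; cases "0 \<le> j") auto
  then show ?thesis
    by (simp only:) (intro computable_int_diff computable_intros computable_nat_minus assms)
qed

lemma computable_minus_int [computable_intros]:
  fixes f :: "'a::numbered \<Rightarrow> int"
  assumes "computable f"
  shows "computable (\<lambda>x. - f x)"
proof -
  have eq: "(\<lambda>x. - f x) = (\<lambda>x. int (nat (- f x)) - int (nat (f x)))"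
    by auto
  show ?thesis
    unfolding eq by (intro computable_int_diff computable_intros computable_nat_minus assms)
qed

lemma computable_less_int [computable_intros]:
  fixes f g :: "'a::numbered \<Rightarrow> int"
  assumes "computable f" "computable g"
  shows "computable (\<lambda>x. f x < g x)"
proof -
  have "computable (\<lambda>x. 0 < nat (g x + - f x))"
    by (intro computable_intros assms)
  then show ?thesis by simp
qed

lemma computable_eq_int [computable_intros]:
  fixes f g :: "'a::numbered \<Rightarrow> int"
  assumes "computable f" "computable g"
  shows "computable (\<lambda>x. f x = g x)"
proof -
  have "computable (\<lambda>x. \<not> f x < g x \<and> \<not> g x < f x)"
    by (intro computable_intros assms)
  then show ?thesis
    by (rule back_subst[of computable]) auto
qed

section \<open>Rational arithmetic on numerator-denominator pairs\<close>

definition fract :: "int \<times> int \<Rightarrow> rat" where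
  "fract p = Fract (fst p) (snd p)"

lemma dec_rat_eq: "dec n = fract (dec n)"
  by (simp add: dec_rat_def nat_to_rat_surj_def fract_def dec_prod_def dec_int_def split: prod.splits)

lemma computable_rat_unop:
  assumes "computable F" "\<And>p. op (fract p) = fract (F p)"
  shows "computable op"
  by (rule computableI[OF computableD(1)[OF assms(1)]])
    (simp add: dec_rat_eq assms(2) computableD(2)[OF assms(1)])

lemma dec_rat_prod: "(dec n :: rat \<times> rat) = map_prod fract fract (dec n)"
proof -
  have "(dec :: nat \<Rightarrow> rat) = fract \<circ> dec"
    by (simp add: fun_eq_iff dec_rat_eq)
  then show ?thesis
    by (simp add: dec_prod_def prod.map_comp)
qed

lemma computable_rat_binop:
  assumes "computable F" "\<And>p q. op (fract p) (fract q) = fract (F (p, q))"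
  shows "computable (\<lambda>z. op (fst z) (snd z))"
proof (rule computableI[OF computableD(1)[OF assms(1)]])
  fix n
  let ?d = "dec n :: (int \<times> int) \<times> (int \<times> int)" and ?q = "dec n :: rat \<times> rat"
  show "op (fst ?q) (snd ?q) = dec (realizer F n)"
    using assms(2)[of "fst ?d" "snd ?d"] computableD(2)[OF assms(1), of n]
    by (simp add: dec_rat_prod dec_rat_eq)
qed

lemma computable_rat_binrel:
  assumes "computable F" "\<And>p q. op (fract p) (fract q) = F (p, q)"
  shows "computable (\<lambda>z. op (fst z) (snd z))"
proof (rule computableI[OF computableD(1)[OF assms(1)]])
  fix n
  let ?d = "dec n :: (int \<times> int) \<times> (int \<times> int)" and ?q = "dec n :: rat \<times> rat"
  show "op (fst ?q) (snd ?q) = dec (realizer F n)"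
    using assms(2)[of "fst ?d" "snd ?d"] computableD(2)[OF assms(1), of n]
    by (simp add: dec_rat_prod)
qed

text \<open>Codes with denominator 0 belong to the numbering, so the operations on pairs have to
  treat them as 0.\<close>

lemma fract_0_denom: "snd p = 0 \<Longrightarrow> fract p = 0"
  by (simp add: fract_def eq_rat Zero_rat_def)

lemma computable_add_rat [computable_intros]:
  fixes f g :: "'a::numbered \<Rightarrow> rat"
  assumes "computable f" "computable g"
  shows "computable (\<lambda>x. f x + g x)"
proof -
  \<comment> \<open>A pair with denominator 0 denotes 0, so the other pair is the sum; cross
    multiplication would produce denominator 0 and lose it.\<close>
  let ?F = "\<lambda>z :: (int \<times> int) \<times> (int \<times> int).
    if snd (fst z) = 0 then snd z else if snd (snd z) = 0 then fst z
    else (fst (fst z) * snd (snd z) + fst (snd z) * snd (fst z), snd (fst z) * snd (snd z))"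
  have "computable ?F"
    by (intro computable_intros)
  then have "computable (\<lambda>z. (fst z :: rat) + snd z)"
    by (rule computable_rat_binop) (auto simp: fract_0_denom, simp add: fract_def)
  from computable_compose[OF this computable_Pair[OF assms]] show ?thesis by simp
qed

lemma computable_mult_rat [computable_intros]:
  fixes f g :: "'a::numbered \<Rightarrow> rat"
  assumes "computable f" "computable g"
  shows "computable (\<lambda>x. f x * g x)"
proof -
  let ?F = "\<lambda>z :: (int \<times> int) \<times> (int \<times> int).
    (fst (fst z) * fst (snd z), snd (fst z) * snd (snd z))"
  have "computable ?F"
    by (intro computable_intros)
  then have "computable (\<lambda>z. (fst z :: rat) * snd z)"
    by (rule computable_rat_binop) (simp add: fract_def)
  from computable_compose[OF this computable_Pair[OF assms]] show ?thesis by simp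
qed

lemma computable_minus_rat [computable_intros]:
  fixes f :: "'a::numbered \<Rightarrow> rat"
  assumes "computable f"
  shows "computable (\<lambda>x. - f x)"
proof -
  have "computable (\<lambda>p :: int \<times> int. (- fst p, snd p))"
    by (intro computable_intros)
  then have "computable (uminus :: rat \<Rightarrow> rat)"
    by (rule computable_rat_unop) (simp add: fract_def)
  from computable_compose[OF this assms] show ?thesis .
qed

lemma computable_diff_rat [computable_intros]:
  fixes f g :: "'a::numbered \<Rightarrow> rat"
  assumes "computable f" "computable g"
  shows "computable (\<lambda>x. f x - g x)"
  unfolding diff_conv_add_uminus by (intro computable_intros assms)

lemma computable_less_rat [computable_intros]:
  fixes f g :: "'a::numbered \<Rightarrow> rat"
  assumes "computable f" "computable g"
  shows "computable (\<lambda>x. f x < g x)"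
proof -
  \<comment> \<open>In the last branch both fractions are multiplied by the square of the product of
    the denominators, which is positive whatever their signs.\<close>
  let ?F = "\<lambda>z :: (int \<times> int) \<times> (int \<times> int).
    if snd (fst z) = 0 then 0 < fst (snd z) * snd (snd z)
    else if snd (snd z) = 0 then fst (fst z) * snd (fst z) < 0
    else fst (fst z) * snd (snd z) * (snd (fst z) * snd (snd z))
      < fst (snd z) * snd (fst z) * (snd (fst z) * snd (snd z))"
  have "computable ?F"
    by (intro computable_intros)
  moreover have "fract p < fract q \<longleftrightarrow> ?F (p, q)" for p q
  proof (cases "snd p = 0 \<or> snd q = 0")
    case True
    have "0 < fract q \<longleftrightarrow> 0 < fst q * snd q" if "snd q \<noteq> 0" for q
      using that less_rat[of 1 "snd q" 0 "fst q"] by (simp add: fract_def Zero_rat_def)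
    moreover have "fract p < 0 \<longleftrightarrow> fst p * snd p < 0" if "snd p \<noteq> 0" for p
      using that less_rat[of "snd p" 1 "fst p" 0] by (simp add: fract_def Zero_rat_def)
    ultimately show ?thesis
      using True by (auto simp: fract_0_denom)
  next
    case False
    then show ?thesis by (simp add: fract_def)
  qed
  ultimately have "computable (\<lambda>z. (fst z :: rat) < snd z)"
    by (rule computable_rat_binrel)
  from computable_compose[OF this computable_Pair[OF assms]] show ?thesis by simp
qed

lemma computable_abs_rat [computable_intros]:
  fixes f :: "'a::numbered \<Rightarrow> rat"
  assumes "computable f"
  shows "computable (\<lambda>x. \<bar>f x\<bar>)"
  unfolding abs_if by (intro computable_intros assms)

lemma computable_power_rat [computable_intros]:
  fixes f :: "'a::numbered \<Rightarrow> rat"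
  assumes "computable f" "computable g"
  shows "computable (\<lambda>x. f x ^ g x)"
proof -
  have "rec_nat 1 (\<lambda>_ y. y * a) n = a ^ n" for a :: rat and n
    by (induction n) (auto simp: mult.commute)
  moreover have "computable (\<lambda>x. rec_nat 1 (\<lambda>_ y. y * f x) (g x))"
    by (intro computable_intros assms computable_compose[OF assms(1)])
  ultimately show ?thesis by simp
qed

subsection \<open>A uniform enumeration of the left-c.e. reals\<close>

fun recf_code :: "recf \<Rightarrow> nat" where
  "recf_code Zero = prod_encode (0, 0)"
| "recf_code Succ = prod_encode (1, 0)"
| "recf_code (Proj i) = prod_encode (2, i)"
| "recf_code (Comp f gs) =
    prod_encode (3, prod_encode (recf_code f, list_encode (map recf_code gs)))"
| "recf_code (PrimRec f g) = prod_encode (4, prod_encode (recf_code f, recf_code g))"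
| "recf_code (Mu f) = prod_encode (5, recf_code f)"

type_synonym judgement = "nat \<times> nat list \<times> nat"

text \<open>
  The judgement \<open>(p, xs, y)\<close> follows by one rule of \<^const>\<open>rec_eval\<close> from earlier
  judgements.  The quantifier \<open>B\<close> over the earlier judgements is a parameter, so that the same
  text yields a decidable test on lists and a monotone condition on sets.
\<close>
definition justified ::
    "((judgement \<Rightarrow> bool) \<Rightarrow> bool) \<Rightarrow> nat \<Rightarrow> nat list \<Rightarrow> nat \<Rightarrow> bool" where
  "justified B p xs y \<longleftrightarrow>
    fst (prod_decode p) = 0 \<and> y = 0 \<or>
    fst (prod_decode p) = 1 \<and> length xs = 1 \<and> y = Suc (nth0 xs 0) \<or>
    fst (prod_decode p) = 2 \<and> snd (prod_decode p) < length xs \<and> y = nth0 xs (snd (prod_decode p)) \<or>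
    fst (prod_decode p) = 3 \<and>
      B (\<lambda>J. fst J = fst (prod_decode (snd (prod_decode p))) \<and> snd (snd J) = y \<and>
        length (fst (snd J)) = length (list_decode (snd (prod_decode (snd (prod_decode p))))) \<and>
        (\<forall>l<length (fst (snd J)). B (\<lambda>J'.
          J' = (nth0 (list_decode (snd (prod_decode (snd (prod_decode p))))) l, xs,
            nth0 (fst (snd J)) l)))) \<or>
    fst (prod_decode p) = 4 \<and> xs \<noteq> [] \<and> nth0 xs 0 = 0 \<and>
      B (\<lambda>J. J = (fst (prod_decode (snd (prod_decode p))), tl xs, y)) \<or>
    fst (prod_decode p) = 4 \<and> xs \<noteq> [] \<and> nth0 xs 0 \<noteq> 0 \<and>
      B (\<lambda>J. fst J = p \<and> fst (snd J) = (nth0 xs 0 - 1) # tl xs \<and>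
        B (\<lambda>J'. J' = (snd (prod_decode (snd (prod_decode p))),
          (nth0 xs 0 - 1) # snd (snd J) # tl xs, y))) \<or>
    fst (prod_decode p) = 5 \<and> B (\<lambda>J. J = (snd (prod_decode p), y # xs, 0)) \<and>
      (\<forall>m<y. B (\<lambda>J. fst J = snd (prod_decode p) \<and> fst (snd J) = m # xs \<and> snd (snd J) \<noteq> 0))"

definition valid_derivation :: "judgement list \<Rightarrow> bool" where
  "valid_derivation D \<longleftrightarrow> (\<forall>i<length D. justified (\<lambda>P. \<exists>j<i. P (nth0 D j))
    (fst (nth0 D i)) (fst (snd (nth0 D i))) (snd (snd (nth0 D i))))"

text \<open>With earlier positions of the list for \<open>B\<close>, every quantifier is
  bounded.\<close>

lemma computable_valid_derivation: "computable valid_derivation"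
  unfolding valid_derivation_def justified_def by (intro computable_intros)

abbreviation justified_by :: "judgement set \<Rightarrow> nat \<Rightarrow> nat list \<Rightarrow> nat \<Rightarrow> bool" where
  "justified_by K \<equiv> justified (\<lambda>P. \<exists>J\<in>K. P J)"

lemma valid_derivation_iff:
  "valid_derivation D \<longleftrightarrow> (\<forall>i<length D. \<forall>p xs y. D ! i = (p, xs, y) \<longrightarrow>
    justified_by (set (take i D)) p xs y)"
proof -
  have "(\<exists>j<i. P (nth0 D j)) \<longleftrightarrow> (\<exists>J\<in>set (take i D). P J)" if "i < length D" for i P
    using that by (auto simp: nth_image[symmetric] nth0_eq)
  then show ?thesis
    unfolding valid_derivation_def by (auto simp: nth0_eq)
qed

text \<open>The quantifier \<open>B\<close> occurs only positively in \<open>justified\<close>. This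
  is what allows derivations to be concatenated.\<close>

lemma justified_by_mono:
  assumes "justified_by K p xs y" "K \<subseteq> L"
  shows "justified_by L p xs y"
proof -
  have bex: "\<exists>J\<in>L. Q J" if "\<exists>J\<in>K. P J" "\<And>J. P J \<Longrightarrow> Q J" for P Q
    using that assms(2) by blast
  show ?thesis
    using assms(1) unfolding justified_def
    by (elim disj_forward conj_forward all_forward imp_forward bex) assumption+
qed

lemma valid_derivation_append:
  assumes "valid_derivation D" "valid_derivation E"
  shows "valid_derivation (D @ E)"
  unfolding valid_derivation_iff
proof (intro allI impI)
  fix i p xs y
  assume i: "i < length (D @ E)" "(D @ E) ! i = (p, xs, y)"
  show "justified_by (set (take i (D @ E))) p xs y"
  proof (cases "i < length D")
    case True
    then show ?thesis
      using assms(1) i unfolding valid_derivation_iff by (simp add: nth_append)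
  next
    case False
    then have "justified_by (set (take (i - length D) E)) p xs y"
      using assms(2) i unfolding valid_derivation_iff by (simp add: nth_append)
    then show ?thesis
      by (rule justified_by_mono) (use False in auto)
  qed
qed

lemma valid_derivation_snoc:
  assumes "valid_derivation D" "justified_by (set D) p xs y"
  shows "valid_derivation (D @ [(p, xs, y)])"
  using assms unfolding valid_derivation_iff by (auto simp: nth_append less_Suc_eq)

definition derivable :: "nat \<Rightarrow> nat list \<Rightarrow> nat \<Rightarrow> bool" where
  "derivable p xs y \<longleftrightarrow> (\<exists>D. valid_derivation D \<and> (p, xs, y) \<in> set D)"

lemma derivable_finite:
  assumes "finite K" "\<And>p xs y. (p, xs, y) \<in> K \<Longrightarrow> derivable p xs y"
  shows "\<exists>D. valid_derivation D \<and> K \<subseteq> set D"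
  using assms
proof (induction K)
  case empty
  show ?case by (intro exI[of _ "[]"]) (simp add: valid_derivation_def)
next
  case (insert J K)
  then obtain D where D: "valid_derivation D" "K \<subseteq> set D" by auto
  obtain p xs y where J: "J = (p, xs, y)" by (cases J)
  with insert.prems obtain E where "valid_derivation E" "J \<in> set E"
    unfolding derivable_def by blast
  with D show ?case
    by (intro exI[of _ "D @ E"]) (auto intro: valid_derivation_append)
qed

text \<open>Derivations of finitely many premises are concatenated and the conclusion is appended;
  each rule of \<open>rec_eval\<close> becomes one application.\<close>

lemma derivable_step:
  assumes "finite K" "\<And>p xs y. (p, xs, y) \<in> K \<Longrightarrow> derivable p xs y" "justified_by K p xs y"
  shows "derivable p xs y"
proof -
  obtain D where D: "valid_derivation D" "K \<subseteq> set D"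
    using derivable_finite[OF assms(1,2)] by blast
  then have "valid_derivation (D @ [(p, xs, y)])"
    using assms(3) by (intro valid_derivation_snoc) (auto intro: justified_by_mono)
  then show ?thesis
    unfolding derivable_def by (intro exI[of _ "D @ [(p, xs, y)]"]) simp
qed

lemma derivable_complete: "rec_eval p xs y \<Longrightarrow> derivable (recf_code p) xs y"
proof (induction rule: rec_eval.induct)
  case (1 xs)
  show ?case by (rule derivable_step[of "{}"]) (simp_all add: justified_def)
next
  case (2 x)
  show ?case by (rule derivable_step[of "{}"]) (simp_all add: justified_def nth0_eq)
next
  case (3 i xs)
  then show ?case by - (rule derivable_step[of "{}"], simp_all add: justified_def nth0_eq)
next
  case (4 xs gs ys f z)
  have len: "length gs = length ys"
    using "4.IH"(1) by (rule list_all2_lengthD)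
  have gs: "derivable (recf_code (gs ! l)) xs (ys ! l)" if "l < length ys" for l
    using list_all2_nthD2[OF "4.IH"(1) that] by blast
  let ?J = "(recf_code f, ys, z)" and ?L = "(\<lambda>l. (recf_code (gs ! l), xs, ys ! l)) ` {..<length ys}"
  show ?case
  proof (rule derivable_step[of "insert ?J ?L"])
    show "derivable p xs' y" if "(p, xs', y) \<in> insert ?J ?L" for p xs' y
      using that gs "4.IH"(2) by auto
    have "\<forall>l<length ys. \<exists>J\<in>insert ?J ?L. J = (nth0 (map recf_code gs) l, xs, nth0 ys l)"
      using len by (simp add: nth0_eq)
    then show "justified_by (insert ?J ?L) (recf_code (Comp f gs)) xs z"
      unfolding justified_def using len by simp
  qed simp
next
  case (5 f xs z g)
  then show ?case
    by - (rule derivable_step[of "{(recf_code f, xs, z)}"], simp_all add: justified_def nth0_eq)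
next
  case (6 f g n xs y z)
  let ?K = "{(recf_code (PrimRec f g), n # xs, y), (recf_code g, n # y # xs, z)}"
  show ?case
  proof (rule derivable_step[of ?K])
    show "derivable p xs' y'" if "(p, xs', y') \<in> ?K" for p xs' y'
      using that "6.IH" by auto
    show "justified_by ?K (recf_code (PrimRec f g)) (Suc n # xs) z"
      unfolding justified_def by (simp add: nth0_eq)
  qed simp
next
  case (7 f n xs)
  \<comment> \<open>Choosing one nonzero value for each argument below \<open>n\<close> leaves
    finitely many premises.\<close>
  have "\<forall>m. \<exists>k. m < n \<longrightarrow> derivable (recf_code f) (m # xs) (Suc k)"
    using "7.IH"(2) by auto
  then obtain k where k: "\<forall>m. m < n \<longrightarrow> derivable (recf_code f) (m # xs) (Suc (k m))"
    by (rule choice[THEN exE])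
  let ?L = "(\<lambda>m. (recf_code f, m # xs, Suc (k m))) ` {..<n}"
  show ?case
  proof (rule derivable_step[of "insert (recf_code f, n # xs, 0) ?L"])
    show "derivable p xs' y" if "(p, xs', y) \<in> insert (recf_code f, n # xs, 0) ?L" for p xs' y
      using that k "7.IH"(1) by auto
    show "justified_by (insert (recf_code f, n # xs, 0) ?L) (recf_code (Mu f)) xs n"
      unfolding justified_def by simp
  qed simp
qed

text \<open>Strong induction on the position: the constructor of \<open>p\<close> fixes the tag of
  its code and hence the applicable clauses, whose premises stand earlier in the list.\<close>

lemma valid_derivation_sound:
  assumes "valid_derivation D" "i < length D" "D ! i = (recf_code p, xs, y)"
  shows "rec_eval p xs y"
  using assms(2,3)
proof (induction i arbitrary: p xs y rule: less_induct)
  case (less i)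
  have IH: "rec_eval q zs w" if "(recf_code q, zs, w) \<in> set (take i D)" for q zs w
    using that less by (auto simp: in_set_conv_nth)
  have J: "justified_by (set (take i D)) (recf_code p) xs y"
    using assms(1) less.prems unfolding valid_derivation_iff by blast
  show ?case
  proof (cases p)
    case Zero
    then show ?thesis using J by (auto simp: justified_def intro: rec_eval.intros)
  next
    case Succ
    then show ?thesis
      using J by (auto simp: justified_def nth0_eq length_Suc_conv intro: rec_eval.intros)
  next
    case (Proj k)
    then show ?thesis using J by (auto simp: justified_def nth0_eq intro: rec_eval.intros)
  next
    case (Comp f gs)
    with J obtain ys where ys: "(recf_code f, ys, y) \<in> set (take i D)" "length ys = length gs"
      "\<And>l. l < length ys \<Longrightarrow>
        (nth0 (map recf_code gs) l, xs, nth0 ys l) \<in> set (take i D)"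
      by (auto simp: justified_def)
    have "rec_eval (gs ! l) xs (ys ! l)" if "l < length ys" for l
      by (rule IH) (use ys(2) ys(3)[OF that] that in \<open>simp add: nth0_eq\<close>)
    then have "list_all2 (\<lambda>g y. rec_eval g xs y) gs ys"
      using ys(2) by (simp add: list_all2_conv_all_nth)
    then show ?thesis
      unfolding Comp using IH[OF ys(1)] by (rule rec_eval.intros(4))
  next
    case (PrimRec f g)
    show ?thesis
    proof (cases xs)
      case Nil
      then show ?thesis using J PrimRec by (simp add: justified_def)
    next
      case (Cons n zs)
      show ?thesis
      proof (cases n)
        case 0
        then have "(recf_code f, zs, y) \<in> set (take i D)"
          using J PrimRec Cons by (simp add: justified_def nth0_eq)
        then show ?thesis
          unfolding PrimRec Cons 0 by (intro rec_eval.intros(5) IH)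
      next
        case (Suc m)
        with J PrimRec Cons obtain w where
          "(recf_code p, m # zs, w) \<in> set (take i D)" "(recf_code g, m # w # zs, y) \<in> set (take i D)"
          by (auto simp: justified_def nth0_eq)
        then have "rec_eval p (m # zs) w" "rec_eval g (m # w # zs) y"
          by (simp_all add: IH)
        then show ?thesis
          unfolding PrimRec Cons Suc by (rule rec_eval.intros(6))
      qed
    qed
  next
    case (Mu f)
    have "\<exists>k. rec_eval f (m # xs) (Suc k)" if "m < y" for m
    proof -
      have "\<exists>J\<in>set (take i D). fst J = recf_code f \<and> fst (snd J) = m # xs \<and> snd (snd J) \<noteq> 0"
        using J that unfolding Mu justified_def by simp
      then obtain w where "(recf_code f, m # xs, w) \<in> set (take i D)" "w \<noteq> 0"
        by auto
      then show ?thesis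
        using IH[of f "m # xs" w] by (cases w) auto
    qed
    moreover have "rec_eval f (y # xs) 0"
      using J unfolding Mu justified_def by (intro IH) simp
    ultimately show ?thesis
      unfolding Mu by (intro rec_eval.intros(7)) blast+
  qed
qed

text \<open>Kleene's T predicate, with a coded derivation \<open>d\<close> as the record of the
  computation.\<close>

definition halts_via :: "nat \<Rightarrow> nat \<Rightarrow> nat \<Rightarrow> bool" where
  "halts_via p n d \<longleftrightarrow> valid_derivation (dec d) \<and>
    (\<exists>i<length (dec d :: judgement list). fst (nth0 (dec d :: judgement list) i) = p \<and>
      fst (snd (nth0 (dec d :: judgement list) i)) = [n])"

lemma computable_halts_via [computable_intros]:
  assumes "computable f" "computable g" "computable h"
  shows "computable (\<lambda>x. halts_via (f x) (g x) (h x))"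
  unfolding halts_via_def
  by (intro computable_intros computable_compose[OF computable_valid_derivation] assms
      computable_compose[OF assms(1)] computable_compose[OF assms(2)] computable_compose[OF assms(3)])

lemma ex_halts_via_iff: "(\<exists>d. halts_via (recf_code p) n d) \<longleftrightarrow> (\<exists>y. rec_eval p [n] y)"
proof
  assume "\<exists>d. halts_via (recf_code p) n d"
  then obtain D :: "judgement list" and i where "valid_derivation D" "i < length D"
    "fst (D ! i) = recf_code p" "fst (snd (D ! i)) = [n]"
    unfolding halts_via_def by (auto simp: nth0_eq)
  then have "rec_eval p [n] (snd (snd (D ! i)))"
    by (intro valid_derivation_sound[of D i]) (auto simp: prod_eq_iff)
  then show "\<exists>y. rec_eval p [n] y" by blast
next
  assume "\<exists>y. rec_eval p [n] y"
  then obtain y where "rec_eval p [n] y" by blast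
  then have "derivable (recf_code p) [n] y"
    by (rule derivable_complete)
  then obtain D i where "valid_derivation D" "i < length D" "D ! i = (recf_code p, [n], y)"
    unfolding derivable_def in_set_conv_nth by blast
  moreover obtain d where "D = dec d"
    using surjD[OF surj_dec] by blast
  ultimately show "\<exists>d. halts_via (recf_code p) n d"
    unfolding halts_via_def by (intro exI[of _ d] conjI exI[of _ i]) (simp_all add: nth0_eq)
qed

text \<open>\<open>Mu\<close> searches for a witness \<open>s\<close> and halts exactly if there is
  one.\<close>

lemma ce_nat_set_ex:
  fixes P :: "nat \<Rightarrow> nat \<Rightarrow> bool"
  assumes "computable (\<lambda>z. P (fst z) (snd z))"
  shows "ce_nat_set {n. \<exists>s. P n s}"
proof -
  define h where "h = realizer (\<lambda>z. P (fst z) (snd z))"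
  have h: "P n s \<longleftrightarrow> h (prod_encode (n, s)) = 0" for n s
    using computableD(2)[OF assms, of "prod_encode (n, s)"]
    by (simp add: h_def dec_prod_def dec_nat_def dec_bool_def)
  have "computable_fun h"
    unfolding h_def using assms by (rule computableD)
  then obtain q where q: "\<And>n. rec_eval q [n] (h n)"
    unfolding computable_fun_def by blast
  obtain e where e: "\<And>x y. rec_eval e [x, y] (prod_encode (x, y))"
    using ex_rec_prod_encode by blast
  define f where "f = Comp q [Comp e [Proj 1, Proj 0]]"
  have f: "rec_eval f [s, n] (h (prod_encode (n, s)))" for s n
    unfolding f_def
    by (rule rec_eval_Comp1[OF rec_eval_Comp2[OF _ _ e] q]) (auto intro: rec_eval_Proj_eq)
  have "(\<exists>s. P n s) \<longleftrightarrow> (\<exists>y. rec_eval (Mu f) [n] y)" for n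
  proof
    assume "\<exists>s. P n s"
    then have "\<exists>s. h (prod_encode (n, s)) = 0"
      by (simp add: h)
    with f have "rec_eval (Mu f) [n] (LEAST s. h (prod_encode (n, s)) = 0)"
      by (rule rec_eval_Mu_Least)
    then show "\<exists>y. rec_eval (Mu f) [n] y" ..
  next
    assume "\<exists>y. rec_eval (Mu f) [n] y"
    then obtain y where "rec_eval (Mu f) [n] y" ..
    then have "rec_eval f [y, n] 0"
      by (cases rule: rec_eval.cases) simp
    then have "h (prod_encode (n, y)) = 0"
      by (rule rec_eval_deterministic[OF f])
    then have "P n y"
      by (simp add: h)
    then show "\<exists>s. P n s" ..
  qed
  then show ?thesis
    unfolding ce_nat_set_def by (intro exI[of _ "Mu f"]) simp
qed

section \<open>Left-c.e. reals and their rational approximations\<close>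

lemma left_ce_iff: "left_ce x \<longleftrightarrow> ce_nat_set {n. real_of_rat (dec n) < x}"
  by (simp add: left_ce_def ce_rat_set_def dec_rat_def)

text \<open>The left cut consists of the rationals below some term of \<open>a\<close>, which is a
  projection of a decidable relation.\<close>

lemma left_ceI:
  assumes "computable a" "\<And>s. real_of_rat (a s) \<le> x" "(\<lambda>s. real_of_rat (a s)) \<longlonglongrightarrow> x"
  shows "left_ce x"
proof -
  have "real_of_rat q < x \<longleftrightarrow> (\<exists>s. q < a s)" for q
  proof
    assume "real_of_rat q < x"
    from order_tendstoD(1)[OF assms(3) this] obtain s where "real_of_rat q < real_of_rat (a s)"
      by (auto simp: eventually_sequentially)
    then show "\<exists>s. q < a s"
      by (auto simp: of_rat_less)
  next
    assume "\<exists>s. q < a s"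
    then obtain s where "real_of_rat q < real_of_rat (a s)"
      by (auto simp: of_rat_less)
    with assms(2)[of s] show "real_of_rat q < x" by simp
  qed
  moreover have "ce_nat_set {n :: nat. \<exists>s. dec n < a s}"
    by (intro ce_nat_set_ex computable_intros computable_compose[OF assms(1)])
  ultimately show ?thesis
    by (simp add: left_ce_iff)
qed

text \<open>
  The approximations from below of all left-c.e. reals: \<open>e\<close> codes a program for the left cut
  together with a rational below the real, and stage \<open>i\<close> inspects one candidate derivation.
\<close>
definition approx :: "nat \<Rightarrow> nat \<Rightarrow> rat" where
  "approx e s = rec_nat (dec (snd (prod_decode e)))
    (\<lambda>i q. if halts_via (fst (prod_decode e)) (fst (prod_decode i)) (snd (prod_decode i))
        \<and> q < dec (fst (prod_decode i))
      then dec (fst (prod_decode i)) else q) s"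

lemma computable_approx [computable_intros]:
  assumes "computable f" "computable g"
  shows "computable (\<lambda>x. approx (f x) (g x))"
  unfolding approx_def by (intro computable_intros assms computable_compose[OF assms(1)])

lemma incseq_approx: "incseq (approx e)"
  by (rule incseq_SucI) (simp add: approx_def)

lemma left_ce_approx:
  assumes "left_ce x"
  shows "\<exists>e. (\<forall>s. real_of_rat (approx e s) < x) \<and> (\<lambda>s. real_of_rat (approx e s)) \<longlonglongrightarrow> x"
proof -
  obtain p where p: "{n. real_of_rat (dec n) < x} = {n. \<exists>y. rec_eval p [n] y}"
    using assms unfolding left_ce_iff ce_nat_set_def by blast
  have halts: "real_of_rat (dec n) < x \<longleftrightarrow> (\<exists>d. halts_via (recf_code p) n d)" for n
    using p by (auto simp: ex_halts_via_iff)
  \<comment> \<open>The starting value must be a rational strictly below \<open>x\<close>.\<close>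
  obtain c where c: "dec c = (of_int (\<lfloor>x\<rfloor> - 1) :: rat)"
    using surjD[OF surj_dec] by metis
  define e where "e = prod_encode (recf_code p, c)"
  have step: "approx e (Suc i) =
      (if halts_via (recf_code p) (fst (prod_decode i)) (snd (prod_decode i))
        \<and> approx e i < dec (fst (prod_decode i)) then dec (fst (prod_decode i)) else approx e i)" for i
    by (simp add: approx_def e_def)
  have less: "real_of_rat (approx e s) < x" for s
  proof (induction s)
    case 0
    have "approx e 0 = of_int (\<lfloor>x\<rfloor> - 1)"
      using c by (simp add: approx_def e_def)
    moreover have "of_int \<lfloor>x\<rfloor> - 1 < x" by linarith
    ultimately show ?case by (simp add: of_rat_diff)
  next
    case (Suc i)
    then show ?case
      using halts by (auto simp: step)
  qed
  have "(\<lambda>s. real_of_rat (approx e s)) \<longlonglongrightarrow> x"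
  proof (rule order_tendstoI)
    fix y assume "y < x"
    then obtain q where q: "y < real_of_rat q" "real_of_rat q < x"
      using of_rat_dense by blast
    obtain n where n: "dec n = q"
      using surjD[OF surj_dec] by metis
    with q halts obtain d where d: "halts_via (recf_code p) n d" by blast
    \<comment> \<open>Stage \<open>prod_encode (n, d)\<close> inspects exactly this candidate with
      this derivation.\<close>
    have "q \<le> approx e (Suc (prod_encode (n, d)))"
      using n d by (simp add: step)
    then have "y < real_of_rat (approx e s)" if "s \<ge> Suc (prod_encode (n, d))" for s
      using incseqD[OF incseq_approx that, of e] q by (meson less_le_trans of_rat_less_eq order_trans)
    then show "eventually (\<lambda>s. y < real_of_rat (approx e s)) sequentially"
      unfolding eventually_sequentially by blast
  next
    fix y assume "x < y"
    then show "eventually (\<lambda>s. real_of_rat (approx e s) < y) sequentially"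
      using less by (intro always_eventually allI) (meson less_trans)
  qed
  with less show ?thesis by blast
qed

lemma left_ceE:
  assumes "left_ce x"
  obtains a where "computable a" "incseq a" "\<And>s. real_of_rat (a s) < x"
    "(\<lambda>s. real_of_rat (a s)) \<longlonglongrightarrow> x"
proof -
  obtain e where e: "\<And>s. real_of_rat (approx e s) < x" "(\<lambda>s. real_of_rat (approx e s)) \<longlonglongrightarrow> x"
    using left_ce_approx[OF assms] by blast
  have "computable (approx e)"
    using computable_approx[OF computable_const computable_id] .
  with e incseq_approx that show thesis by blast
qed

lemma left_ce_add:
  assumes "left_ce x" "left_ce y"
  shows "left_ce (x + y)"
proof -
  obtain a where a: "computable a" "\<And>s. real_of_rat (a s) < x" "(\<lambda>s. real_of_rat (a s)) \<longlonglongrightarrow> x"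
    using left_ceE[OF assms(1)] by metis
  obtain b where b: "computable b" "\<And>s. real_of_rat (b s) < y" "(\<lambda>s. real_of_rat (b s)) \<longlonglongrightarrow> y"
    using left_ceE[OF assms(2)] by metis
  show ?thesis
  proof (rule left_ceI)
    show "computable (\<lambda>s. a s + b s)"
      by (intro computable_intros a b)
    show "real_of_rat (a s + b s) \<le> x + y" for s
      using a(2)[of s] b(2)[of s] by (simp add: of_rat_add)
    show "(\<lambda>s. real_of_rat (a s + b s)) \<longlonglongrightarrow> x + y"
      unfolding of_rat_add by (intro tendsto_add a b)
  qed
qed

lemma left_ce_mult_of_rat:
  assumes "left_ce x" "0 \<le> q"
  shows "left_ce (real_of_rat q * x)"
proof -
  obtain a where a: "computable a" "\<And>s. real_of_rat (a s) < x" "(\<lambda>s. real_of_rat (a s)) \<longlonglongrightarrow> x"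
    using left_ceE[OF assms(1)] by metis
  show ?thesis
  proof (rule left_ceI)
    show "computable (\<lambda>s. q * a s)"
      by (intro computable_intros a)
    show "real_of_rat (q * a s) \<le> real_of_rat q * x" for s
      using a(2)[of s] assms(2) by (simp add: of_rat_mult mult_left_mono less_imp_le)
    show "(\<lambda>s. real_of_rat (q * a s)) \<longlonglongrightarrow> real_of_rat q * x"
      unfolding of_rat_mult by (intro tendsto_mult tendsto_const a)
  qed
qed

text \<open>Since \<open>q < - x\<close> iff \<open>x < - q\<close>, negation on codes followed by a
  program for the right cut of \<open>x\<close> accepts the left cut of \<open>- x\<close>.\<close>

lemma right_ce_imp_left_ce_minus:
  assumes "right_ce x"
  shows "left_ce (- x)"
proof -
  obtain p where p: "{n. x < real_of_rat (dec n)} = {n. \<exists>y. rec_eval p [n] y}"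
    using assms unfolding right_ce_def ce_rat_set_def ce_nat_set_def dec_rat_def by auto
  have c: "computable (\<lambda>q :: rat. - q)"
    by (intro computable_intros)
  let ?g = "realizer (\<lambda>q :: rat. - q)"
  obtain g where g: "\<And>n. rec_eval g [n] (?g n)"
    using computableD(1)[OF c] unfolding computable_fun_def by blast
  have "real_of_rat (dec n) < - x \<longleftrightarrow> x < real_of_rat (dec (?g n))" for n
    using computableD(2)[OF c, of n, symmetric] by (simp add: of_rat_minus) linarith
  also have "x < real_of_rat (dec (?g n)) \<longleftrightarrow> (\<exists>y. rec_eval p [?g n] y)" for n
    using p by blast
  also have "(\<exists>y. rec_eval p [?g n] y) \<longleftrightarrow> (\<exists>y. rec_eval (Comp p [g]) [n] y)" for n
  proof
    assume "\<exists>y. rec_eval p [?g n] y"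
    then show "\<exists>y. rec_eval (Comp p [g]) [n] y"
      using rec_eval_Comp1[OF g] by blast
  next
    assume "\<exists>y. rec_eval (Comp p [g]) [n] y"
    then obtain y where "rec_eval (Comp p [g]) [n] y" ..
    then obtain m where "rec_eval g [n] m" "rec_eval p [m] y"
      by (cases rule: rec_eval.cases) (auto simp: list_all2_Cons1)
    then show "\<exists>y. rec_eval p [?g n] y"
      using rec_eval_deterministic[OF g] by blast
  qed
  finally show ?thesis
    unfolding left_ce_iff ce_nat_set_def by blast
qed

text \<open>The two approximations enclose \<open>x\<close> between \<open>a s\<close> and
  \<open>- b s\<close>; the search is for a stage at which this interval is shorter than
  \<open>2^-n\<close>.\<close>

lemma computable_real_if_left_ce:
  assumes "left_ce x" "left_ce (- x)"
  shows "computable_real x"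
proof -
  obtain a where a: "computable a" "\<And>s. real_of_rat (a s) < x" "(\<lambda>s. real_of_rat (a s)) \<longlonglongrightarrow> x"
    using left_ceE[OF assms(1)] by metis
  obtain b where b: "computable b" "\<And>s. real_of_rat (b s) < - x" "(\<lambda>s. real_of_rat (b s)) \<longlonglongrightarrow> - x"
    using left_ceE[OF assms(2)] by metis
  have ex: "\<exists>s. - ((1 / 2) ^ n) < a s + b s" for n
  proof -
    have "(\<lambda>s. real_of_rat (a s + b s)) \<longlonglongrightarrow> x + - x"
      unfolding of_rat_add by (intro tendsto_add a b)
    moreover have "- ((1 / 2) ^ n) < x + - x" by simp
    ultimately have "eventually (\<lambda>s. - ((1 / 2) ^ n) < real_of_rat (a s + b s)) sequentially"
      by (rule order_tendstoD)
    then obtain s where "- ((1 / 2) ^ n) < real_of_rat (a s + b s)"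
      by (auto simp: eventually_sequentially)
    moreover have "- ((1 / 2) ^ n) = real_of_rat (- ((1 / 2) ^ n))"
      by (simp add: of_rat_minus of_rat_power of_rat_divide)
    ultimately show ?thesis
      by (simp only: of_rat_less) blast
  qed
  define t where "t n = (LEAST s. - ((1 / 2) ^ n) < a s + b s)" for n
  have t: "- ((1 / 2) ^ n) < a (t n) + b (t n)" for n
    unfolding t_def using ex by (rule LeastI_ex)
  have c: "computable (\<lambda>n. a (t n))"
    unfolding t_def
    by (intro computable_compose[OF a(1)] computable_compose[OF b(1)] computable_Least computable_intros ex)
  define r where "r = realizer (\<lambda>n. a (t n))"
  have r: "computable_fun r" "nat_to_rat_surj (r n) = a (t n)" for n
    unfolding r_def using computableD(1)[OF c] computableD(2)[OF c, of n, symmetric]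
    by (simp_all only: dec_nat_def dec_rat_def)
  have "\<bar>x - real_of_rat (a (t n))\<bar> \<le> 1 / 2 ^ n" for n
  proof -
    have "real_of_rat (- ((1 / 2) ^ n)) < real_of_rat (a (t n) + b (t n))"
      using t[of n] by (simp only: of_rat_less)
    then have "- (1 / 2 ^ n) < real_of_rat (a (t n)) + real_of_rat (b (t n))"
      by (simp add: of_rat_minus of_rat_power of_rat_divide of_rat_add power_divide)
    then show ?thesis
      using a(2)[of "t n"] b(2)[of "t n"] by simp
  qed
  then show ?thesis
    unfolding computable_real_def using r by (intro exI[of _ r]) simp
qed

subsection \<open>The finite injury construction\<close>

lemma length_filter_mono:
  "(\<And>x. P x \<Longrightarrow> Q x) \<Longrightarrow> length (filter P xs) \<le> length (filter Q xs)"
  by (induction xs) auto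

text \<open>
  A stage consists of the requirements that have acted so far, latest first, and of the current
  values of \<open>u\<close> and \<open>v\<close>.  With \<open>d = \<alpha> + u - v\<close>, requirement \<open>2 * e\<close> is that
  \<open>- d\<close> differs from the left-c.e. real with index \<open>e\<close>, and requirement \<open>2 * e + 1\<close> is that
  \<open>d\<close> does.
\<close>
type_synonym stage = "nat list \<times> rat \<times> rat"

text \<open>The bounds by 1 keep the total contribution of requirement \<open>k\<close> at most
  \<open>2^-k\<close>, so \<open>u\<close> and \<open>v\<close> stay bounded.\<close>

locale construction =
  fixes a h w :: "nat \<Rightarrow> rat"
  assumes computable_a: "computable a"
    and computable_h: "computable h" and computable_w: "computable w"
    and incseq_h: "incseq h" and incseq_w: "incseq w"
    and h_bounded: "h n - h 0 \<le> 1" and w_bounded: "w n - w 0 \<le> 1"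
begin

definition gap :: "nat \<Rightarrow> nat \<Rightarrow> rat" where
  "gap k n = (if even k then h n else w n)"

definition discrepancy :: "nat \<Rightarrow> nat \<Rightarrow> stage \<Rightarrow> rat" where
  "discrepancy k s S =
    (if even k then - (a s + fst (snd S) - snd (snd S)) else a s + fst (snd S) - snd (snd S))
    - approx (k div 2) s"

text \<open>The threshold halves with every action of a requirement up to \<open>k\<close>. If
  \<open>k\<close> acts infinitely often, its discrepancy becomes arbitrarily small at its actions;
  if all of these requirements stop, the threshold stays a positive constant.\<close>

definition attention :: "nat \<Rightarrow> nat \<Rightarrow> stage \<Rightarrow> bool" where
  "attention k s S \<longleftrightarrow> \<bar>discrepancy k s S\<bar> < (1 / 2) ^ length (filter (\<lambda>j. j \<le> k) (fst S))"

text \<open>The value \<open>s\<close> means that no requirement below \<open>s\<close> requires attention.\<close>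
definition selected :: "nat \<Rightarrow> stage \<Rightarrow> nat" where
  "selected s S = (LEAST k. k = s \<or> attention k s S)"

text \<open>
  The \<open>n\<close>-th action of \<open>k\<close> copies the \<open>n\<close>-th increment of \<open>h\<close> or \<open>w\<close>, whoever was injured in
  between.  The factor depends on the actions of the requirements before \<open>k\<close> only, so it is
  eventually constant, while each action of a requirement halves the factors of all later ones.
\<close>
definition increment :: "nat \<Rightarrow> stage \<Rightarrow> rat" where
  "increment k S = (1 / 2) ^ (k + length (filter (\<lambda>j. j < k) (fst S))) *
    (gap k (Suc (length (filter (\<lambda>j. j = k) (fst S))))
      - gap k (length (filter (\<lambda>j. j = k) (fst S))))"

definition step :: "nat \<Rightarrow> stage \<Rightarrow> stage" where
  "step s S = (if selected s S < s
    then (selected s S # fst S,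
      fst (snd S) + (if even (selected s S) then increment (selected s S) S else 0),
      snd (snd S) + (if even (selected s S) then 0 else increment (selected s S) S))
    else S)"

definition stage :: "nat \<Rightarrow> stage" where
  "stage = rec_nat ([], 0, 0) step"

section \<open>Computability of the construction\<close>

lemma computable_gap:
  assumes "computable f" "computable g"
  shows "computable (\<lambda>x. gap (f x) (g x))"
  unfolding gap_def
  by (intro computable_intros computable_compose[OF computable_h] computable_compose[OF computable_w]
      assms)

lemma computable_attention:
  assumes "computable f" "computable g" "computable S"
  shows "computable (\<lambda>x. attention (f x) (g x) (S x))"
  unfolding attention_def discrepancy_def
  by (intro computable_intros computable_compose[OF computable_a] assms computable_compose[OF assms(1)])

lemma computable_selected:
  assumes "computable g" "computable S"
  shows "computable (\<lambda>x. selected (g x) (S x))"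
  unfolding selected_def
  by (intro computable_Least computable_attention computable_intros
      computable_compose[OF assms(1)] computable_compose[OF assms(2)]) blast

lemma computable_increment:
  assumes "computable f" "computable S"
  shows "computable (\<lambda>x. increment (f x) (S x))"
  unfolding increment_def
  by (intro computable_gap computable_intros assms computable_compose[OF assms(1)])

lemma computable_stage: "computable stage"
proof -
  have "computable (\<lambda>s. rec_nat ([], 0, 0) step s)"
    unfolding step_def by (intro computable_intros computable_selected computable_increment)
  then show ?thesis by (simp add: stage_def)
qed

lemmas computable_stage_compose = computable_compose[OF computable_stage]

section \<open>Histories, accumulators and action counts\<close>

definition history :: "nat \<Rightarrow> nat list" where "history s = fst (stage s)"
definition acc :: "bool \<Rightarrow> nat \<Rightarrow> rat" where
  "acc b s = (if b then fst (snd (stage s)) else snd (snd (stage s)))"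
definition act :: "nat \<Rightarrow> nat" where "act s = selected s (stage s)"
definition acts :: "nat \<Rightarrow> nat \<Rightarrow> bool" where "acts k s \<longleftrightarrow> act s = k \<and> k < s"
definition count :: "nat \<Rightarrow> nat \<Rightarrow> nat" where "count k s = length (filter (\<lambda>j. j = k) (history s))"
definition count_below :: "nat \<Rightarrow> nat \<Rightarrow> nat" where "count_below k s = length (filter (\<lambda>j. j < k) (history s))"
definition count_upto :: "nat \<Rightarrow> nat \<Rightarrow> nat" where "count_upto k s = length (filter (\<lambda>j. j \<le> k) (history s))"

lemmas stage_defs = history_def acc_def act_def count_def count_below_def count_upto_def

lemma history_0: "history 0 = []"
  by (simp add: history_def stage_def)

lemma history_Suc: "history (Suc s) = (if act s < s then act s # history s else history s)"
  by (simp add: history_def act_def stage_def step_def)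

lemma acc_0: "acc b 0 = 0"
  by (simp add: acc_def stage_def)

lemma acc_Suc:
  "acc b (Suc s) = acc b s + (if act s < s \<and> even (act s) = b
    then (1 / 2) ^ (act s + count_below (act s) s) *
      (gap (act s) (Suc (count (act s) s)) - gap (act s) (count (act s) s)) else 0)"
  by (simp add: stage_defs stage_def step_def increment_def)

lemma count_Suc: "count k (Suc s) = (if acts k s then Suc (count k s) else count k s)"
  by (auto simp: count_def history_Suc acts_def)

lemma incseq_count: "incseq (count k)"
  by (rule incseq_SucI) (simp add: count_Suc)

lemma incseq_count_upto: "incseq (count_upto k)"
  by (rule incseq_SucI) (simp add: count_upto_def history_Suc)

lemma count_le: "count k s \<le> s"
proof (induction s)
  case 0
  show ?case by (simp add: count_def history_0)
qed (simp add: count_Suc)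

lemma count_le_upto: "count k s \<le> count_upto k s"
  unfolding count_def count_upto_def by (rule length_filter_mono) simp

lemma count_upto_le_below: "k < j \<Longrightarrow> count_upto k s \<le> count_below j s"
  unfolding count_below_def count_upto_def by (rule length_filter_mono) simp

section \<open>Growth of the two accumulators\<close>

lemma incseq_gap: "incseq (gap k)"
  using incseq_h incseq_w by (cases "even k") (simp_all add: gap_def[abs_def])

lemma gap_diff_le: "gap k m - gap k n \<le> 1"
  using incseqD[OF incseq_gap[of k], of 0 n] h_bounded[of m] w_bounded[of m]
  by (auto simp: gap_def split: if_splits)

lemma incseq_acc: "incseq (acc b)"
  by (rule incseq_SucI) (simp add: acc_Suc incseq_SucD[OF incseq_gap])

text \<open>Consecutive increments copied by requirement \<open>j\<close> telescope, and each
  carries a factor of at most \<open>2^-(j + M)\<close>. The fixed bound \<open>T\<close> keeps the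
  index range of the sum unchanged during the induction on \<open>t\<close>.\<close>

lemma acc_growth_sum:
  assumes "s \<le> t" "t \<le> T"
    and "\<And>r. s \<le> r \<Longrightarrow> r < t \<Longrightarrow> act r < r \<Longrightarrow> even (act r) = b \<Longrightarrow>
      l \<le> act r \<and> M \<le> count_below (act r) r"
  shows "acc b t - acc b s \<le> (\<Sum>j\<in>{l..<T}. (1 / 2) ^ (j + M) * (gap j (count j t) - gap j (count j s)))"
  using assms
proof (induction t rule: dec_induct)
  case base
  show ?case by simp
next
  case (step t)
  define f where "f r j = (1 / 2 :: rat) ^ (j + M) * (gap j (count j r) - gap j (count j s))" for r j
  have IH: "acc b t - acc b s \<le> (\<Sum>j\<in>{l..<T}. f t j)"
    unfolding f_def by (rule step.IH) (use step.prems in auto)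
  have mono: "f t j \<le> f (Suc t) j" for j
    unfolding f_def
    by (intro mult_left_mono diff_right_mono incseqD[OF incseq_gap] incseq_SucD[OF incseq_count]) simp
  have "acc b (Suc t) - acc b t \<le> (\<Sum>j\<in>{l..<T}. f (Suc t) j - f t j)"
  proof (cases "act t < t \<and> even (act t) = b")
    case False
    then have "acc b (Suc t) - acc b t = 0"
      by (simp only: acc_Suc if_False)
    also have "0 \<le> (\<Sum>j\<in>{l..<T}. f (Suc t) j - f t j)"
      using mono by (intro sum_nonneg) simp
    finally show ?thesis .
  next
    case True
    let ?k = "act t"
    have k: "l \<le> ?k" "M \<le> count_below ?k t"
      using step.prems(2)[of t] step.hyps True by auto
    have "acc b (Suc t) - acc b t =
        (1 / 2) ^ (?k + count_below ?k t) * (gap ?k (Suc (count ?k t)) - gap ?k (count ?k t))"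
      using True by (simp add: acc_Suc)
    also have "\<dots> \<le> (1 / 2) ^ (?k + M) * (gap ?k (Suc (count ?k t)) - gap ?k (count ?k t))"
      using k by (intro mult_right_mono power_decreasing) (simp_all add: incseq_SucD[OF incseq_gap])
    also have "\<dots> = f (Suc t) ?k - f t ?k"
      using True by (simp add: f_def count_Suc acts_def algebra_simps)
    \<comment> \<open>The acting requirement lies below the stage number, hence below
      \<open>T\<close>, and the other terms are nonnegative.\<close>
    also have "\<dots> \<le> (\<Sum>j\<in>{l..<T}. f (Suc t) j - f t j)"
      using mono k True step.prems(1) by (intro member_le_sum) auto
    finally show ?thesis .
  qed
  then show ?case
    using IH by (simp add: sum_subtractf flip: f_def)
qed

lemma sum_half_powers_le: "(\<Sum>j\<in>{l..<T}. (1 / 2 :: rat) ^ (j + M)) \<le> 2 * (1 / 2) ^ (l + M)"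
proof (cases "l \<le> T")
  case True
  then have "(\<Sum>j\<in>{l..<T}. (1 / 2 :: rat) ^ (j + M)) = 2 * (1 / 2) ^ (l + M) - 2 * (1 / 2) ^ (T + M)"
    by (induction T rule: dec_induct) auto
  then show ?thesis by simp
qed simp

text \<open>The unit bound on the copied sequences reduces the claim to a geometric series. The
  parameter \<open>M\<close> bounds from below how often earlier requirements have already acted, so
  a large \<open>M\<close> makes the growth small.\<close>

lemma acc_growth_le:
  assumes "s \<le> t"
    and "\<And>r. s \<le> r \<Longrightarrow> r < t \<Longrightarrow> act r < r \<Longrightarrow> even (act r) = b \<Longrightarrow>
      l \<le> act r \<and> M \<le> count_below (act r) r"
  shows "acc b t - acc b s \<le> 2 * (1 / 2) ^ (l + M)"
proof -
  have "acc b t - acc b s \<le> (\<Sum>j\<in>{l..<t}. (1 / 2) ^ (j + M) * (gap j (count j t) - gap j (count j s)))"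
    by (rule acc_growth_sum[OF assms(1) order_refl]) (use assms(2) in blast)
  also have "\<dots> \<le> (\<Sum>j\<in>{l..<t}. (1 / 2) ^ (j + M) * 1)"
    by (intro sum_mono mult_left_mono gap_diff_le) simp
  also have "\<dots> \<le> 2 * (1 / 2) ^ (l + M)"
    using sum_half_powers_le by simp
  finally show ?thesis .
qed

text \<open>While no requirement before \<open>k\<close> acts, the factor of \<open>k\<close> is
  frozen and its own increments telescope; other requirements of the same parity can only enlarge
  the accumulator.\<close>

lemma acc_growth_ge:
  assumes "s \<le> t" and "\<And>r. s \<le> r \<Longrightarrow> r < t \<Longrightarrow> act r < r \<Longrightarrow> k \<le> act r"
  shows "count_below k t = count_below k s \<and>
    (1 / 2) ^ (k + count_below k s) * (gap k (count k t) - gap k (count k s))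
      \<le> acc (even k) t - acc (even k) s"
  using assms
proof (induction t rule: dec_induct)
  case base
  show ?case by simp
next
  case (step t)
  have IH: "count_below k t = count_below k s"
    "(1 / 2) ^ (k + count_below k s) * (gap k (count k t) - gap k (count k s))
      \<le> acc (even k) t - acc (even k) s"
    using step.IH step.prems by auto
  have "count_below k (Suc t) = count_below k t"
    using step.prems[of t] step.hyps by (auto simp: count_below_def history_Suc)
  moreover have "(1 / 2) ^ (k + count_below k s) * (gap k (count k (Suc t)) - gap k (count k t))
      \<le> acc (even k) (Suc t) - acc (even k) t"
  proof (cases "acts k t")
    case True
    then show ?thesis by (simp add: acts_def acc_Suc count_Suc IH(1)[symmetric])
  next
    case False
    then show ?thesis
      using incseq_SucD[OF incseq_acc] by (simp add: count_Suc)
  qed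
  ultimately show ?case
    using IH by (simp add: algebra_simps)
qed

lemma acc_limit:
  obtains x where "left_ce x" "\<And>s. real_of_rat (acc b s) \<le> x" "(\<lambda>s. real_of_rat (acc b s)) \<longlonglongrightarrow> x"
proof -
  have inc: "incseq (\<lambda>s. real_of_rat (acc b s))"
    using incseq_acc by (simp add: incseq_def of_rat_less_eq)
  have bound: "real_of_rat (acc b s) \<le> 2" for s
  proof -
    have "acc b s - acc b 0 \<le> 2 * (1 / 2) ^ (0 + 0)"
      by (rule acc_growth_le) auto
    then have "real_of_rat (acc b s) \<le> real_of_rat 2"
      unfolding of_rat_less_eq by (simp add: acc_0)
    then show ?thesis by simp
  qed
  obtain x where x: "(\<lambda>s. real_of_rat (acc b s)) \<longlonglongrightarrow> x" "\<And>s. real_of_rat (acc b s) \<le> x"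
    using incseq_convergent[OF inc, of 2] bound by blast
  have "computable (acc b)"
    unfolding acc_def[abs_def]
    by (intro computable_intros computable_stage_compose)
  then have "left_ce x"
    using x by (intro left_ceI)
  with x that show thesis by blast
qed

lemma acc_eq_0: "(\<And>n. h n = 0) \<Longrightarrow> acc True s = 0"
  by (induction s) (auto simp: acc_0 acc_Suc gap_def)

section \<open>Verification of the requirements\<close>

lemma computable_acts:
  assumes "computable f" "computable g"
  shows "computable (\<lambda>x. acts (f x) (g x))"
  unfolding acts_def act_def
  by (intro computable_selected computable_intros computable_stage_compose assms)

lemma computable_count:
  assumes "computable f" "computable g"
  shows "computable (\<lambda>x. count (f x) (g x))"
  unfolding count_def history_def
  by (intro computable_intros computable_stage_compose assms computable_compose[OF assms(1)])

text \<open>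
  At the stages \<open>t n\<close> where \<open>k\<close> acts, its discrepancy is below \<open>2\<^sup>-\<^sup>n\<close> and later requirements
  contribute at most \<open>2\<^sup>-\<^sup>n\<close>, so from there on \<open>\<alpha>\<close> (for even \<open>k\<close>:
  \<open>- \<alpha>\<close>) must make up for what \<open>k\<close> copies.
\<close>
lemma frequently_acts_left_ce:
  assumes freq: "\<And>N. \<exists>s\<ge>N. acts k s"
    and first: "\<And>r. s0 \<le> r \<Longrightarrow> act r < r \<Longrightarrow> k \<le> act r"
    and a: "(\<lambda>s. real_of_rat (a s)) \<longlonglongrightarrow> \<alpha>"
    and g: "(\<lambda>s. real_of_rat (gap k s)) \<longlonglongrightarrow> \<gamma>"
  shows "\<exists>m. left_ce ((if even k then - \<alpha> else \<alpha>) - (1 / 2) ^ m * \<gamma>)"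
proof -
  have ex: "\<exists>s. s0 \<le> s \<and> acts k s \<and> n \<le> count k s" for n
  proof (induction n)
    case 0
    show ?case using freq[of s0] by auto
  next
    case (Suc n)
    then obtain s where s: "s0 \<le> s" "acts k s" "n \<le> count k s" by blast
    obtain r where r: "Suc s \<le> r" "acts k r"
      using freq by blast
    have "Suc n \<le> count k (Suc s)"
      using s by (simp add: count_Suc)
    also have "\<dots> \<le> count k r"
      using r(1) by (rule incseqD[OF incseq_count])
    finally show ?case
      using r s(1) by (intro exI[of _ r]) simp
  qed
  \<comment> \<open>Taking the least such stage makes \<open>t\<close> computable by search and
    nondecreasing.\<close>
  define t where "t n = (LEAST s. s0 \<le> s \<and> acts k s \<and> n \<le> count k s)" for n
  have t: "s0 \<le> t n" "acts k (t n)" "n \<le> count k (t n)" for n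
    using LeastI_ex[OF ex[of n]] by (simp_all add: t_def)
  have t_mono: "t m \<le> t n" if "m \<le> n" for m n
    unfolding t_def[of m] using t[of n] that by (intro Least_le) simp
  \<comment> \<open>The factor of \<open>k\<close>, which is frozen from \<open>s0\<close>
    on.\<close>
  define \<delta> where "\<delta> = (1 / 2 :: rat) ^ (k + count_below k s0)"
  define c where "c s = (if even k then - a s else a s)" for s
  \<comment> \<open>For either parity the accumulator fed by \<open>k\<close> enters with a negative
    sign and the other one with a positive sign.\<close>
  define e where "e s = c s + acc (odd k) s - acc (even k) s" for s
  have e: "discrepancy k s (stage s) = e s - approx (k div 2) s" for s
    by (simp add: discrepancy_def e_def c_def acc_def)
  have close: "\<bar>e (t n) - approx (k div 2) (t n)\<bar> < (1 / 2) ^ n" for n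
  proof -
    have k: "k \<noteq> t n" "selected (t n) (stage (t n)) = k"
      using t(2)[of n] by (auto simp: acts_def act_def)
    have "selected s S = s \<or> attention (selected s S) s S" for s S
      unfolding selected_def by (rule LeastI[of "\<lambda>k. k = s \<or> attention k s S" s]) simp
    from this[of "t n" "stage (t n)"] k have "attention k (t n) (stage (t n))" by simp
    then have "\<bar>e (t n) - approx (k div 2) (t n)\<bar> < (1 / 2) ^ count_upto k (t n)"
      by (simp add: attention_def e count_upto_def history_def)
    also have "\<dots> \<le> (1 / 2) ^ n"
      using t(3)[of n] count_le_upto[of k "t n"] by (intro power_decreasing) auto
    finally show ?thesis .
  qed
  \<comment> \<open>Between \<open>t m\<close> and \<open>t n\<close> the values of
    \<open>approx\<close> do not decrease, so \<open>e\<close> drops by at most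
    \<open>2 * 2^-m\<close>. The other accumulator gains at most \<open>2^-m\<close>, and the one
    fed by \<open>k\<close> gains at least \<open>\<delta>\<close> times the copied
    increments.\<close>
  have lower: "c (t m) - \<delta> * gap k (count k (t m)) - 3 * (1 / 2) ^ m
      \<le> c (t n) - \<delta> * gap k (count k (t n))" if "m \<le> n" for m n
  proof -
    note mn = t_mono[OF that]
    have "approx (k div 2) (t m) \<le> approx (k div 2) (t n)"
      using incseq_approx mn by (rule incseqD)
    moreover have "(1 / 2 :: rat) ^ n \<le> (1 / 2) ^ m"
      using that by (intro power_decreasing) auto
    ultimately have "e (t m) - 2 * (1 / 2) ^ m \<le> e (t n)"
      using close[of m] close[of n] by linarith
    moreover have "acc (odd k) (t n) - acc (odd k) (t m) \<le> (1 / 2) ^ m"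
    proof -
      have "acc (odd k) (t n) - acc (odd k) (t m) \<le> 2 * (1 / 2) ^ (Suc k + count_upto k (t m))"
      proof (rule acc_growth_le[OF mn])
        fix r
        assume r: "t m \<le> r" "r < t n" "act r < r" "even (act r) = odd k"
        \<comment> \<open>Parity excludes \<open>k\<close> itself, so the indices start at
          \<open>Suc k\<close>; this also cancels the factor 2 of the geometric bound.\<close>
        then have "k < act r"
          using first[of r] t(1)[of m] by (cases "act r = k") auto
        moreover have "count_upto k (t m) \<le> count_upto k r"
          using r(1) by (rule incseqD[OF incseq_count_upto])
        ultimately show "Suc k \<le> act r \<and> count_upto k (t m) \<le> count_below (act r) r"
          using count_upto_le_below[of k "act r" r] by simp
      qed
      also have "\<dots> = (1 / 2) ^ (k + count_upto k (t m))" by simp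
      also have "\<dots> \<le> (1 / 2) ^ m"
        using t(3)[of m] count_le_upto[of k "t m"] by (intro power_decreasing) auto
      finally show ?thesis .
    qed
    moreover have "\<delta> * (gap k (count k (t n)) - gap k (count k (t m)))
        \<le> acc (even k) (t n) - acc (even k) (t m)"
    proof -
      have "count_below k (t m) = count_below k s0"
        using acc_growth_ge[of s0 "t m" k] t(1) first by blast
      then show ?thesis
        using acc_growth_ge[OF mn, of k] first t(1)[of m] by (auto simp: \<delta>_def)
    qed
    ultimately show ?thesis
      unfolding e_def by (simp add: right_diff_distrib)
  qed
  \<comment> \<open>By \<open>lower\<close> the subtracted power makes every \<open>x n\<close> a
    lower bound of the limit, and it vanishes as \<open>n\<close> grows.\<close>
  define x where "x n = c (t n) - \<delta> * gap k (count k (t n)) - 3 * (1 / 2) ^ n" for n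
  define z where "z = (if even k then - \<alpha> else \<alpha>) - real_of_rat \<delta> * \<gamma>"
  have t_top: "filterlim t at_top sequentially"
  proof (rule filterlim_at_top_mono[OF filterlim_ident])
    show "\<forall>\<^sub>F n in sequentially. n \<le> t n"
      using order_trans[OF t(3) count_le] by (intro always_eventually allI)
  qed
  have count_top: "filterlim (\<lambda>n. count k (t n)) at_top sequentially"
    by (rule filterlim_at_top_mono[OF filterlim_ident]) (simp add: t(3) always_eventually)
  have lim: "(\<lambda>n. real_of_rat (c (t n) - \<delta> * gap k (count k (t n)))) \<longlonglongrightarrow> z"
  proof -
    have "(\<lambda>s. real_of_rat (c s)) \<longlonglongrightarrow> (if even k then - \<alpha> else \<alpha>)"
      using a tendsto_minus[OF a] by (simp add: c_def of_rat_minus)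
    from filterlim_compose[OF this t_top] filterlim_compose[OF g count_top] show ?thesis
      unfolding z_def of_rat_diff of_rat_mult by (intro tendsto_diff tendsto_mult_left)
  qed
  have "left_ce z"
  proof (rule left_ceI)
    have "computable t"
      unfolding t_def
      by (intro computable_Least computable_acts computable_count computable_intros ex)
    then show "computable x"
      unfolding x_def c_def
      by (intro computable_intros computable_gap computable_count
          computable_compose[OF computable_a] computable_compose[OF \<open>computable t\<close>])
    show "real_of_rat (x m) \<le> z" for m
    proof (rule LIMSEQ_le_const[OF lim])
      show "\<exists>N. \<forall>n\<ge>N. real_of_rat (x m) \<le> real_of_rat (c (t n) - \<delta> * gap k (count k (t n)))"
        using lower by (auto simp: x_def of_rat_less_eq)
    qed
    have "(\<lambda>n. 3 * (1 / 2 :: real) ^ n) \<longlonglongrightarrow> 3 * 0"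
      by (intro tendsto_mult tendsto_const LIMSEQ_power_zero) simp
    from tendsto_diff[OF lim this] show "(\<lambda>n. real_of_rat (x n)) \<longlonglongrightarrow> z"
      by (simp add: x_def of_rat_diff of_rat_mult of_rat_power of_rat_divide)
  qed
  then show ?thesis
    unfolding z_def \<delta>_def by (intro exI[of _ "k + count_below k s0"]) (simp add: of_rat_power of_rat_divide)
qed

text \<open>Finite injury, by induction on priority: once the earlier requirements have stopped,
  infinitely many actions of \<open>k\<close> would make one of the excluded reals left-c.e.\<close>

lemma eventually_not_acts:
  assumes a: "(\<lambda>s. real_of_rat (a s)) \<longlonglongrightarrow> \<alpha>"
    and h: "(\<lambda>s. real_of_rat (h s)) \<longlonglongrightarrow> \<eta>" and w: "(\<lambda>s. real_of_rat (w s)) \<longlonglongrightarrow> \<omega>"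
    and not_even: "\<And>m. \<not> left_ce (- \<alpha> - (1 / 2) ^ m * \<eta>)"
    and not_odd: "\<And>m. \<not> left_ce (\<alpha> - (1 / 2) ^ m * \<omega>)"
  shows "\<forall>\<^sub>F s in sequentially. \<not> acts k s"
proof (induction k rule: less_induct)
  case (less k)
  have "\<forall>\<^sub>F s in sequentially. \<forall>j\<in>{..<k}. \<not> acts j s"
    by (rule eventually_ball_finite) (use less in auto)
  then obtain s0 where s0: "\<And>s j. s0 \<le> s \<Longrightarrow> j < k \<Longrightarrow> \<not> acts j s"
    unfolding eventually_sequentially by auto
  have first: "k \<le> act r" if "s0 \<le> r" "act r < r" for r
    using s0[OF that(1), of "act r"] that(2) unfolding acts_def by (meson not_le)
  have gap: "(\<lambda>s. real_of_rat (gap k s)) \<longlonglongrightarrow> (if even k then \<eta> else \<omega>)"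
    using h w by (simp add: gap_def)
  show ?case
  proof (rule ccontr)
    assume "\<not> (\<forall>\<^sub>F s in sequentially. \<not> acts k s)"
    then have freq: "\<exists>s\<ge>N. acts k s" for N
      by (auto simp: eventually_sequentially)
    show False
      using frequently_acts_left_ce[of k s0, OF freq first a gap] not_even not_odd
      by (cases "even k") auto
  qed
qed

text \<open>If \<open>\<alpha> + u - v\<close> or its negative were left-c.e. with index
  \<open>e\<close>, the discrepancy of the corresponding requirement would tend to 0 while its
  threshold is eventually constant. Some requirement up to it would then act after all of these have
  stopped.\<close>

lemma construction_succeeds:
  assumes a: "(\<lambda>s. real_of_rat (a s)) \<longlonglongrightarrow> \<alpha>"
    and h: "(\<lambda>s. real_of_rat (h s)) \<longlonglongrightarrow> \<eta>" and w: "(\<lambda>s. real_of_rat (w s)) \<longlonglongrightarrow> \<omega>"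
    and not_even: "\<And>m. \<not> left_ce (- \<alpha> - (1 / 2) ^ m * \<eta>)"
    and not_odd: "\<And>m. \<not> left_ce (\<alpha> - (1 / 2) ^ m * \<omega>)"
  obtains u v where "left_ce u" "left_ce v" "(\<And>n. h n = 0) \<Longrightarrow> u = 0"
    "\<not> left_ce (\<alpha> + u - v)" "\<not> left_ce (- (\<alpha> + u - v))"
proof -
  obtain u where u: "left_ce u" "(\<lambda>s. real_of_rat (acc True s)) \<longlonglongrightarrow> u"
    using acc_limit[of True] by metis
  obtain v where v: "left_ce v" "(\<lambda>s. real_of_rat (acc False s)) \<longlonglongrightarrow> v"
    using acc_limit[of False] by metis
  have u0: "u = 0" if "\<And>n. h n = 0"
    using u(2) acc_eq_0[OF that] by (simp add: LIMSEQ_const_iff)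
  have no: "\<not> left_ce (if even k then - (\<alpha> + u - v) else \<alpha> + u - v)"
    if e: "k div 2 = e" and lim: "(\<lambda>s. real_of_rat (approx e s)) \<longlonglongrightarrow>
      (if even k then - (\<alpha> + u - v) else \<alpha> + u - v)" for k e
  proof -
    have "\<forall>\<^sub>F s in sequentially. \<forall>j\<in>{..k}. \<not> acts j s"
      by (intro eventually_ball_finite ballI eventually_not_acts[OF a h w not_even not_odd]) simp
    then obtain s0 where s0: "\<And>s j. s0 \<le> s \<Longrightarrow> j \<le> k \<Longrightarrow> \<not> acts j s"
      unfolding eventually_sequentially by auto
    have const: "count_upto k s = count_upto k s0" if "s0 \<le> s" for s
      using that
    proof (induction s rule: dec_induct)
      case (step s)
      have "\<not> (act s < s \<and> act s \<le> k)"
        using s0[of s "act s"] step.hyps by (auto simp: acts_def)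
      with step.IH show ?case
        by (auto simp: count_upto_def history_Suc)
    qed simp
    have "(\<lambda>s. real_of_rat (discrepancy k s (stage s))) \<longlonglongrightarrow> 0"
    proof (cases "even k")
      case True
      have "(\<lambda>s. - (real_of_rat (a s) + real_of_rat (acc True s) - real_of_rat (acc False s))
          - real_of_rat (approx e s)) \<longlonglongrightarrow> - (\<alpha> + u - v) - (- (\<alpha> + u - v))"
        using lim True by (intro tendsto_intros a u v) simp
      then show ?thesis
        using True by (simp add: discrepancy_def acc_def e of_rat_diff of_rat_add of_rat_minus)
    next
      case False
      have "(\<lambda>s. (real_of_rat (a s) + real_of_rat (acc True s) - real_of_rat (acc False s))
          - real_of_rat (approx e s)) \<longlonglongrightarrow> (\<alpha> + u - v) - (\<alpha> + u - v)"
        using lim False by (intro tendsto_intros a u v) simp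
      then show ?thesis
        using False by (simp add: discrepancy_def acc_def e of_rat_diff of_rat_add of_rat_minus)
    qed
    then have "(\<lambda>s. \<bar>real_of_rat (discrepancy k s (stage s))\<bar>) \<longlonglongrightarrow> 0"
      by (rule tendsto_rabs_zero)
    from order_tendstoD(2)[OF this, of "real_of_rat ((1 / 2) ^ count_upto k s0)"]
    obtain s1 where s1: "\<And>s. s1 \<le> s \<Longrightarrow>
        \<bar>real_of_rat (discrepancy k s (stage s))\<bar> < real_of_rat ((1 / 2) ^ count_upto k s0)"
      by (auto simp: eventually_sequentially)
    \<comment> \<open>The condition \<open>k < s\<close> ensures that the selected index is a
      genuine action and not the idle value \<open>s\<close>.\<close>
    define s where "s = Max {s0, s1, Suc k}"
    have s: "s0 \<le> s" "s1 \<le> s" "k < s"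
      by (auto simp: s_def less_max_iff_disj)
    have "real_of_rat \<bar>discrepancy k s (stage s)\<bar> < real_of_rat ((1 / 2) ^ count_upto k s)"
      using s1[OF s(2)] const[OF s(1)] by simp
    then have "attention k s (stage s)"
      by (simp only: of_rat_less attention_def count_upto_def history_def)
    \<comment> \<open>An earlier requirement may be selected instead of \<open>k\<close>, but it has
      stopped acting as well.\<close>
    then have "act s \<le> k"
      unfolding act_def selected_def by (intro Least_le) simp
    then have "acts (act s) s"
      using s(3) by (simp add: acts_def)
    then show ?thesis
      using s0[OF s(1) \<open>act s \<le> k\<close>] by blast
  qed
  have "\<not> left_ce (\<alpha> + u - v)"
  proof
    assume l: "left_ce (\<alpha> + u - v)"
    then obtain e where "(\<lambda>s. real_of_rat (approx e s)) \<longlonglongrightarrow> \<alpha> + u - v"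
      using left_ce_approx by blast
    then show False
      using no[of "Suc (2 * e)" e] l by simp
  qed
  moreover have "\<not> left_ce (- (\<alpha> + u - v))"
  proof
    assume l: "left_ce (- (\<alpha> + u - v))"
    then obtain e where "(\<lambda>s. real_of_rat (approx e s)) \<longlonglongrightarrow> - (\<alpha> + u - v)"
      using left_ce_approx by blast
    then show False
      using no[of "2 * e" e] l by simp
  qed
  ultimately show thesis
    using that u(1) v(1) u0 by blast
qed

end

section \<open>Unit-bounded approximations and the choice of \<beta>\<close>

lemma ex_unit_tail:
  assumes "left_ce x"
  obtains b where "computable b" "incseq b" "\<And>n. b n - b 0 \<le> 1" "(\<lambda>s. real_of_rat (b s)) \<longlonglongrightarrow> x"
proof -
  obtain b where b: "computable b" "incseq b" "\<And>s. real_of_rat (b s) < x"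
    "(\<lambda>s. real_of_rat (b s)) \<longlonglongrightarrow> x"
    using left_ceE[OF assms] by metis
  \<comment> \<open>Beyond a term within 1 of the limit, all later increases together stay below
    1.\<close>
  obtain N where N: "x - 1 < real_of_rat (b N)"
    using order_tendstoD(1)[OF b(4), of "x - 1"] by (auto simp: eventually_sequentially)
  show thesis
  proof
    show "computable (\<lambda>n. b (n + N))"
      by (intro computable_compose[OF b(1)] computable_intros)
    show "incseq (\<lambda>n. b (n + N))"
      using b(2) by (simp add: incseq_def)
    show "b (n + N) - b (0 + N) \<le> 1" for n
    proof -
      have "real_of_rat (b (n + N) - b (0 + N)) \<le> real_of_rat 1"
        using b(3)[of "n + N"] N by (simp add: of_rat_diff)
      then show ?thesis by (simp only: of_rat_less_eq)
    qed
    show "(\<lambda>s. real_of_rat (b (s + N))) \<longlonglongrightarrow> x"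
      using b(4) by (rule LIMSEQ_ignore_initial_segment)
  qed
qed

lemma computable_real_if_left_ce_scaled:
  assumes "left_ce x" "left_ce (- ((1 / 2) ^ m * x))"
  shows "computable_real x"
proof -
  have "left_ce (real_of_rat (2 ^ m) * (- ((1 / 2) ^ m * x)))"
    using assms(2) by (rule left_ce_mult_of_rat) simp
  then have "left_ce (- x)"
    by (simp add: of_rat_power power_divide)
  with assms(1) show ?thesis
    by (rule computable_real_if_left_ce)
qed

theorem theorem1p1:
  fixes \<alpha> :: real
  assumes "left_ce \<alpha>" and "\<not> computable_real \<alpha>"
  shows "\<exists>\<beta>. left_ce \<beta> \<and>
           (\<forall>\<gamma>. left_ce \<gamma> \<longrightarrow> \<alpha> \<noteq> \<beta> + \<gamma>) \<and>
           (\<forall>\<gamma>. right_ce \<gamma> \<longrightarrow> \<alpha> \<noteq> \<beta> + \<gamma>)"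
proof -
  \<comment> \<open>A left-c.e. \<open>\<gamma>\<close> with
    \<open>\<alpha> = \<beta> + \<gamma>\<close> would be \<open>\<alpha> - \<beta>\<close>, and a
    right-c.e. one would make \<open>- (\<alpha> - \<beta>)\<close> left-c.e.\<close>
  have "\<exists>\<beta>. left_ce \<beta> \<and> \<not> left_ce (\<alpha> - \<beta>) \<and> \<not> left_ce (- (\<alpha> - \<beta>))"
  proof (cases "\<exists>\<omega>. left_ce \<omega> \<and> (\<forall>m. \<not> left_ce (\<alpha> - (1 / 2) ^ m * \<omega>))")
    case True
    then obtain \<omega> where \<omega>: "left_ce \<omega>" "\<And>m. \<not> left_ce (\<alpha> - (1 / 2) ^ m * \<omega>)" by blast
    obtain a where a: "computable a" "(\<lambda>s. real_of_rat (a s)) \<longlonglongrightarrow> \<alpha>"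
      using left_ceE[OF assms(1)] by metis
    obtain w where w: "computable w" "incseq w" "\<And>n. w n - w 0 \<le> 1"
      "(\<lambda>s. real_of_rat (w s)) \<longlonglongrightarrow> \<omega>"
      using ex_unit_tail[OF \<omega>(1)] by metis
    interpret construction a "\<lambda>_. 0" w
      by unfold_locales (use a w in \<open>simp_all add: computable_const incseq_def\<close>)
    show ?thesis
    proof (rule construction_succeeds[OF a(2) _ w(4) _ \<omega>(2)])
      show "(\<lambda>s. real_of_rat 0) \<longlonglongrightarrow> 0" by simp
      \<comment> \<open>With \<open>\<eta> = 0\<close> the condition for even requirements says that
        \<open>- \<alpha>\<close> is not left-c.e.; otherwise the left-c.e. real
        \<open>\<alpha>\<close> would be computable.\<close>
      show "\<not> left_ce (- \<alpha> - (1 / 2) ^ m * 0)" for m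
        using computable_real_if_left_ce assms by auto
    next
      fix u v :: real
      assume uv: "left_ce v" "\<not> left_ce (\<alpha> + u - v)" "\<not> left_ce (- (\<alpha> + u - v))"
        and "(\<And>n :: nat. (0 :: rat) = 0) \<Longrightarrow> u = 0"
      then have "u = 0" by simp
      with uv show ?thesis
        by (intro exI[of _ v]) simp
    qed
  next
    case False
    obtain w where w: "computable w" "incseq w" "\<And>n. w n - w 0 \<le> 1"
      "(\<lambda>s. real_of_rat (w s)) \<longlonglongrightarrow> \<alpha>"
      using ex_unit_tail[OF assms(1)] by metis
    interpret construction "\<lambda>_. 0" w w
      by unfold_locales (use w in \<open>simp_all add: computable_const\<close>)
    \<comment> \<open>With 0 in place of \<open>\<alpha>\<close> both non-left-c.e. hypotheses of
      \<open>construction_succeeds\<close> take this form.\<close>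
    have no: "\<not> left_ce (- ((1 / 2) ^ m * \<alpha>))" for m
      using computable_real_if_left_ce_scaled assms by blast
    obtain u v where uv: "left_ce u" "left_ce v" "\<not> left_ce (u - v)" "\<not> left_ce (v - u)"
    proof (rule construction_succeeds[OF _ w(4) w(4)])
      show "(\<lambda>s. real_of_rat 0) \<longlonglongrightarrow> 0" by simp
      show "\<not> left_ce (- 0 - (1 / 2) ^ m * \<alpha>)" "\<not> left_ce (0 - (1 / 2) ^ m * \<alpha>)" for m
        using no by simp_all
    next
      fix u v :: real
      assume "left_ce u" "left_ce v" "\<not> left_ce (0 + u - v)" "\<not> left_ce (- (0 + u - v))"
      then show thesis
        by (intro that) simp_all
    qed
    \<comment> \<open>The negated case assumption, applied to the left-c.e. real \<open>u\<close>,
      provides \<open>m\<close>.\<close>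
    obtain m where m: "left_ce (\<alpha> - (1 / 2) ^ m * u)"
      using False uv(1) by blast
    define \<beta> where "\<beta> = (\<alpha> - (1 / 2) ^ m * u) + real_of_rat ((1 / 2) ^ m) * v"
    have "left_ce \<beta>"
      unfolding \<beta>_def using m uv(2) by (intro left_ce_add left_ce_mult_of_rat) simp_all
    \<comment> \<open>If \<open>\<alpha> - \<beta>\<close> or its negative were left-c.e., scaling
      by \<open>2^m\<close> would make \<open>u - v\<close> or \<open>v - u\<close>
      left-c.e.\<close>
    moreover have "u - v = real_of_rat (2 ^ m) * (\<alpha> - \<beta>)"
      by (simp add: \<beta>_def of_rat_power of_rat_divide power_divide field_simps)
    then have "\<not> left_ce (\<alpha> - \<beta>)"
      using uv(3) left_ce_mult_of_rat[of "\<alpha> - \<beta>" "2 ^ m"] by auto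
    moreover have "v - u = real_of_rat (2 ^ m) * (- (\<alpha> - \<beta>))"
      by (simp add: \<beta>_def of_rat_power of_rat_divide power_divide field_simps)
    then have "\<not> left_ce (- (\<alpha> - \<beta>))"
      using uv(4) left_ce_mult_of_rat[of "- (\<alpha> - \<beta>)" "2 ^ m"] by auto
    ultimately show ?thesis by blast
  qed
  then obtain \<beta> where \<beta>: "left_ce \<beta>" "\<not> left_ce (\<alpha> - \<beta>)" "\<not> left_ce (- (\<alpha> - \<beta>))" by blast
  have "\<alpha> \<noteq> \<beta> + \<gamma>" if "left_ce \<gamma>" for \<gamma>
    using \<beta>(2) that by auto
  moreover have "\<alpha> \<noteq> \<beta> + \<gamma>" if "right_ce \<gamma>" for \<gamma>
    using \<beta>(3) right_ce_imp_left_ce_minus[OF that] by auto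
  ultimately show ?thesis
    using \<beta>(1) by blast
qed

end
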